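(* Let $n\ge2$ and $1\le k\le n$. In the algebra $\overline{3HT_n(\beta,\boldsymbol h)}$ the shifted multiplicative Dunkl elements $\mathfrak{D}_1,\dots,\mathfrak{D}_n$ satisfy $$\sum_{I\subset[1,n],\,|I|=k}\mathfrak{D}_I\prod_{\substack{i\notin I,\ j\in I\\ i<j}}\bigl(1+t\beta-t^2q_{ij}\bigr)=\sum_{1\le i_1<\cdots<i_k\le n}\ \prod_{a=1}^{k}(1+t\beta)^{n-k-i_a+a}\left(z_{i_a}(1+t\beta)^{i_a-a}+1+h_{i_a}\frac{(1+t\beta)^{i_a-a}-1}{\beta}\right),$$ where $\mathfrak{D}_I=\prod_{a\in I}\mathfrak{D}_a$.
   Context: Let $\beta,t$, $h_2,\dots,h_n$ and $q_{ij}=q_{ji}$ ($1\le i\neq j\le n$) be commuting central parameters, $h_1:=0$, and let the coefficient ring be $\mathbb{Z}[\beta,t,h_2,\dots,h_n,\{q_{ij}\}]$ with all elements $1+\beta t-t^2q_{ij}$ inverted. The algebra $\overline{3HT_n(\beta,\boldsymbol h)}$ is the associative algebra over this ring generated by $u_{ij}$ ($1\le i<j\le n$) and pairwise commuting elements $z_1,\dots,z_n$ subject to: - $u_{ij}u_{kl}=u_{kl}u_{ij}$ if $\{i,j\}\cap\{k,l\}=\varnothing$; - for $i<j<k$: $u_{ij}u_{jk}=u_{ik}u_{ij}+u_{jk}u_{ik}-\beta u_{ik}$ and $u_{jk}u_{ij}=u_{ij}u_{ik}+u_{ik}u_{jk}-\beta u_{ik}$; - $u_{ij}^2-\beta u_{ij}=q_{ij}$;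 - $z_iu_{kl}=u_{kl}z_i$ if $i\notin\{k,l\}$; - for $i<j$: $z_iu_{ij}=u_{ij}z_j+\beta z_i+h_j$ and $z_ju_{ij}=u_{ij}z_i-\beta z_i-h_j$. For $i<j$ put $h_{ij}=1+t\,u_{ij}$; it is invertible, with $h_{ij}^{-1}=(1+\beta t-t^2q_{ij})^{-1}(1+t\beta-tu_{ij})$. The shifted multiplicative Dunkl elements are $$\mathfrak{D}_i=h_{i-1,i}^{-1}h_{i-2,i}^{-1}\cdots h_{1,i}^{-1}\,(1+z_i)\,h_{i,n}h_{i,n-1}\cdots h_{i,i+1};$$ they commute pairwise. The fraction $\frac{(1+t\beta)^m-1}{\beta}$ denotes the polynomial $\sum_{r\ge1}\binom mr t^r\beta^{r-1}$. *)

theory Defs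
  imports
    "HOL-Library.Poly_Mapping"
    "HOL-Library.Countable"
    "HOL-Computational_Algebra.Fraction_Field"
    "HOL-Algebra.Algebra"
    "HOL-Algebra.Algebraic_Closure_Type"
begin

section \<open>The coefficient ring\<close>

datatype param = Pbeta | Pt | Ph nat | Pq nat nat

instance param :: countable
  by countable_datatype

text \<open>An arbitrary linear order on the names of the parameters. It plays no role in the
  mathematics; it is only what the library needs to see that polynomials form a domain.\<close>

instantiation param :: linorder
begin

definition less_eq_param :: "param \<Rightarrow> param \<Rightarrow> bool" where
  "less_eq_param x y \<longleftrightarrow> to_nat x \<le> to_nat y"

definition less_param :: "param \<Rightarrow> param \<Rightarrow> bool" where
  "less_param x y \<longleftrightarrow> to_nat x < to_nat y"

instance
  by standard (auto simp: less_eq_param_def less_param_def)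

end

text \<open>The fraction field of the polynomial ring over the integers in all parameters. The
  coefficient ring for a given \<open>n\<close> is cut out of it below.\<close>

type_synonym param_field = "((param \<Rightarrow>\<^sub>0 nat) \<Rightarrow>\<^sub>0 int) fract"

definition par :: "param \<Rightarrow> param_field" where
  "par v = Fract (Poly_Mapping.single (Poly_Mapping.single v 1) 1) 1"

abbreviation beta :: param_field where "beta \<equiv> par Pbeta"

abbreviation tpar :: param_field where "tpar \<equiv> par Pt"

definition hpar :: "nat \<Rightarrow> param_field" where
  "hpar i = (if i = 1 then 0 else par (Ph i))"

definition qpar :: "nat \<Rightarrow> nat \<Rightarrow> param_field" where
  "qpar i j = par (Pq (min i j) (max i j))"

definition kap :: "nat \<Rightarrow> nat \<Rightarrow> param_field" where
  "kap i j = 1 + beta * tpar - tpar\<^sup>2 * qpar i j"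

text \<open>The localisation of the polynomial ring in \<open>\<beta>, t, h\<^sub>2, \<dots>, h\<^sub>n, q\<^sub>i\<^sub>j\<close> at the elements
  \<open>1 + \<beta> t - t\<^sup>2 q\<^sub>i\<^sub>j\<close>.\<close>

definition coeff_ring :: "nat \<Rightarrow> param_field set" where
  "coeff_ring n = generate_ring ring_of_type_algebra
     ({beta, tpar} \<union> hpar ` {2..n}
      \<union> {qpar i j | i j. 1 \<le> i \<and> i < j \<and> j \<le> n}
      \<union> {inverse (kap i j) | i j. 1 \<le> i \<and> i < j \<and> j \<le> n})"

text \<open>The polynomial \<open>((1 + t \<beta>)\<^sup>m - 1) / \<beta>\<close>.\<close>

definition power_quot :: "nat \<Rightarrow> param_field" where
  "power_quot m = (\<Sum>r = 1..m. of_nat (m choose r) * tpar ^ r * beta ^ (r - 1))"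


section \<open>The free associative algebra\<close>

datatype gen = U nat nat | Z nat

definition gens :: "nat \<Rightarrow> gen set" where
  "gens n = {U i j | i j. 1 \<le> i \<and> i < j \<and> j \<le> n} \<union> Z ` {1..n}"

text \<open>The free monoid on the generators, written additively so that \<open>word \<Rightarrow>\<^sub>0 'a\<close> is its
  monoid algebra, that is, the algebra of noncommutative polynomials.\<close>

datatype word = Word (letters: "gen list")

instantiation word :: monoid_add
begin

definition zero_word :: word where
  "0 = Word []"

definition plus_word :: "word \<Rightarrow> word \<Rightarrow> word" where
  "v + w = Word (letters v @ letters w)"

instance
  by standard (simp_all add: zero_word_def plus_word_def)

end

type_synonym nc_poly = "word \<Rightarrow>\<^sub>0 param_field"

definition const :: "param_field \<Rightarrow> nc_poly" where
  "const c = Poly_Mapping.single 0 c"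

definition gen_u :: "nat \<Rightarrow> nat \<Rightarrow> nc_poly" where
  "gen_u i j = Poly_Mapping.single (Word [U i j]) 1"

definition gen_z :: "nat \<Rightarrow> nc_poly" where
  "gen_z i = Poly_Mapping.single (Word [Z i]) 1"

definition free_alg :: "nat \<Rightarrow> nc_poly ring" where
  "free_alg n = ring_of_type_algebra
     \<lparr>carrier := {p. \<forall>w \<in> Poly_Mapping.keys p.
        Poly_Mapping.lookup p w \<in> coeff_ring n \<and> set (letters w) \<subseteq> gens n}\<rparr>"


section \<open>The algebra defined by generators and relations\<close>

text \<open>Each relation \<open>l = r\<close> is recorded as the element \<open>l - r\<close> of the free algebra.\<close>

definition relators :: "nat \<Rightarrow> nc_poly set" where
  "relators n =
     {gen_z i * gen_z j - gen_z j * gen_z i | i j.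
        1 \<le> i \<and> i \<le> n \<and> 1 \<le> j \<and> j \<le> n}
   \<union> {gen_u i j * gen_u k l - gen_u k l * gen_u i j | i j k l.
        1 \<le> i \<and> i < j \<and> j \<le> n \<and> 1 \<le> k \<and> k < l \<and> l \<le> n \<and> {i, j} \<inter> {k, l} = {}}
   \<union> {gen_u i j * gen_u j k
        - (gen_u i k * gen_u i j + gen_u j k * gen_u i k - const beta * gen_u i k) | i j k.
        1 \<le> i \<and> i < j \<and> j < k \<and> k \<le> n}
   \<union> {gen_u j k * gen_u i j
        - (gen_u i j * gen_u i k + gen_u i k * gen_u j k - const beta * gen_u i k) | i j k.
        1 \<le> i \<and> i < j \<and> j < k \<and> k \<le> n}
   \<union> {(gen_u i j)\<^sup>2 - const beta * gen_u i j - const (qpar i j) | i j.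
        1 \<le> i \<and> i < j \<and> j \<le> n}
   \<union> {gen_z i * gen_u k l - gen_u k l * gen_z i | i k l.
        1 \<le> i \<and> i \<le> n \<and> 1 \<le> k \<and> k < l \<and> l \<le> n \<and> i \<notin> {k, l}}
   \<union> {gen_z i * gen_u i j
        - (gen_u i j * gen_z j + const beta * gen_z i + const (hpar j)) | i j.
        1 \<le> i \<and> i < j \<and> j \<le> n}
   \<union> {gen_z j * gen_u i j
        - (gen_u i j * gen_z i - const beta * gen_z i - const (hpar j)) | i j.
        1 \<le> i \<and> i < j \<and> j \<le> n}"

text \<open>\<open>Idl\<close> is the two-sided ideal generated by a set.\<close>

definition rel_ideal :: "nat \<Rightarrow> nc_poly set" where
  "rel_ideal n = Idl\<^bsub>free_alg n\<^esub> (relators n)"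

definition HT :: "nat \<Rightarrow> nc_poly set ring" where
  "HT n = free_alg n Quot rel_ideal n"

definition cls :: "nat \<Rightarrow> nc_poly \<Rightarrow> nc_poly set" where
  "cls n p = rel_ideal n +>\<^bsub>free_alg n\<^esub> p"

definition scal :: "nat \<Rightarrow> param_field \<Rightarrow> nc_poly set" where
  "scal n c = cls n (const c)"

definition ht_u :: "nat \<Rightarrow> nat \<Rightarrow> nat \<Rightarrow> nc_poly set" where
  "ht_u n i j = cls n (gen_u i j)"

definition ht_z :: "nat \<Rightarrow> nat \<Rightarrow> nc_poly set" where
  "ht_z n i = cls n (gen_z i)"


section \<open>Shifted multiplicative Dunkl elements\<close>

text \<open>The product of a list from left to right.\<close>

definition list_prod :: "('a, 'b) monoid_scheme \<Rightarrow> 'a list \<Rightarrow> 'a" where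
  "list_prod R xs = foldr (\<lambda>x y. x \<otimes>\<^bsub>R\<^esub> y) xs \<one>\<^bsub>R\<^esub>"

definition ht_h :: "nat \<Rightarrow> nat \<Rightarrow> nat \<Rightarrow> nc_poly set" where
  "ht_h n i j = \<one>\<^bsub>HT n\<^esub> \<oplus>\<^bsub>HT n\<^esub> scal n tpar \<otimes>\<^bsub>HT n\<^esub> ht_u n i j"

definition dunkl :: "nat \<Rightarrow> nat \<Rightarrow> nc_poly set" where
  "dunkl n i =
     list_prod (HT n) (map (\<lambda>j. inv\<^bsub>HT n\<^esub> (ht_h n j i)) (rev [1..<i]))
     \<otimes>\<^bsub>HT n\<^esub> (\<one>\<^bsub>HT n\<^esub> \<oplus>\<^bsub>HT n\<^esub> ht_z n i)
     \<otimes>\<^bsub>HT n\<^esub> list_prod (HT n) (map (\<lambda>j. ht_h n i j) (rev [Suc i..<Suc n]))"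

text \<open>The Dunkl elements commute pairwise, so the order of the factors is immaterial; the
  increasing order is chosen.\<close>

definition dunkl_prod :: "nat \<Rightarrow> nat set \<Rightarrow> nc_poly set" where
  "dunkl_prod n I = list_prod (HT n) (map (dunkl n) (sorted_list_of_set I))"


section \<open>The quotient is a ring\<close>

lemma ring_of_type_algebra_simps [simp]:
  "carrier ring_of_type_algebra = UNIV"
  "monoid.mult ring_of_type_algebra = (*)"
  "ring.add ring_of_type_algebra = (+)"
  "monoid.one ring_of_type_algebra = 1"
  "ring.zero ring_of_type_algebra = 0"
  by (auto simp: ring_of_type_algebra_def fun_eq_iff)

lemma ring_ring_of_type_algebra: "ring (ring_of_type_algebra :: 'a :: ring_1 ring)"
proof -
  have "\<exists>y. x + y = 0 \<and> y + x = 0" for x :: 'a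
    by (rule exI[of _ "- x"]) simp
  then show ?thesis
    by unfold_locales (auto simp: algebra_simps Units_def)
qed

lemma a_inv_ring_of_type_algebra [simp]:
  "\<ominus>\<^bsub>ring_of_type_algebra\<^esub> (x :: 'a :: ring_1) = - x"
proof -
  interpret ring "ring_of_type_algebra :: 'a ring"
    by (rule ring_ring_of_type_algebra)
  show ?thesis
    by (rule minus_equality) auto
qed

lemma coeff_ring_1: "1 \<in> coeff_ring n"
  using generate_ring.one[of ring_of_type_algebra] by (simp add: coeff_ring_def)

lemma coeff_ring_uminus: "a \<in> coeff_ring n \<Longrightarrow> - a \<in> coeff_ring n"
  using generate_ring.a_inv[of a ring_of_type_algebra] by (simp add: coeff_ring_def)

lemma coeff_ring_add: "a \<in> coeff_ring n \<Longrightarrow> b \<in> coeff_ring n \<Longrightarrow> a + b \<in> coeff_ring n"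
  using generate_ring.eng_add[of a ring_of_type_algebra _ b] by (simp add: coeff_ring_def)

lemma coeff_ring_mult: "a \<in> coeff_ring n \<Longrightarrow> b \<in> coeff_ring n \<Longrightarrow> a * b \<in> coeff_ring n"
  using generate_ring.eng_mult[of a ring_of_type_algebra _ b] by (simp add: coeff_ring_def)

lemma coeff_ring_0: "0 \<in> coeff_ring n"
  using coeff_ring_add[OF coeff_ring_1 coeff_ring_uminus[OF coeff_ring_1], of n] by simp

lemma coeff_ring_sum: "(\<And>x. x \<in> A \<Longrightarrow> f x \<in> coeff_ring n) \<Longrightarrow> sum f A \<in> coeff_ring n"
  by (induction A rule: infinite_finite_induct) (auto intro: coeff_ring_0 coeff_ring_add)

lemma mem_free_alg_iff:
  "p \<in> carrier (free_alg n) \<longleftrightarrow> (\<forall>w. Poly_Mapping.lookup p w \<in> coeff_ring n)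
     \<and> (\<forall>w \<in> Poly_Mapping.keys p. set (letters w) \<subseteq> gens n)"
proof -
  have "(\<forall>w \<in> Poly_Mapping.keys p. Poly_Mapping.lookup p w \<in> coeff_ring n)
      \<longleftrightarrow> (\<forall>w. Poly_Mapping.lookup p w \<in> coeff_ring n)"
    using coeff_ring_0[of n] by (force simp only: in_keys_iff)
  then show ?thesis
    unfolding free_alg_def by auto
qed

lemma free_alg_mult_closed:
  assumes "p \<in> carrier (free_alg n)" "q \<in> carrier (free_alg n)"
  shows "p * q \<in> carrier (free_alg n)"
proof -
  have "Poly_Mapping.lookup (p * q) w \<in> coeff_ring n" for w
    using assms unfolding lookup_mult Sum_any.expand_set when_def mem_free_alg_iff
    by (auto intro!: coeff_ring_sum coeff_ring_mult coeff_ring_0)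
  moreover have "set (letters w) \<subseteq> gens n" if "w \<in> Poly_Mapping.keys (p * q)" for w
    using that assms keys_mult[of p q] unfolding mem_free_alg_iff plus_word_def by fastforce
  ultimately show ?thesis
    by (simp add: mem_free_alg_iff)
qed

lemma ring_free_alg: "ring (free_alg n)"
proof -
  interpret R: ring "ring_of_type_algebra :: nc_poly ring"
    by (rule ring_ring_of_type_algebra)
  have add: "p + q \<in> carrier (free_alg n)"
    if "p \<in> carrier (free_alg n)" "q \<in> carrier (free_alg n)" for p q
    using that Poly_Mapping.keys_add[of p q]
    by (fastforce simp: mem_free_alg_iff lookup_add intro: coeff_ring_add)
  have "subring (carrier (free_alg n)) ring_of_type_algebra"
  proof (rule R.subringI)
    show "\<one>\<^bsub>ring_of_type_algebra\<^esub> \<in> carrier (free_alg n)"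
      by (simp add: mem_free_alg_iff lookup_one when_def coeff_ring_0 coeff_ring_1 zero_word_def)
  qed (simp_all add: add free_alg_mult_closed,
       auto simp: mem_free_alg_iff intro: coeff_ring_uminus)
  then have "ring (ring_of_type_algebra\<lparr>carrier := carrier (free_alg n)\<rparr>)"
    using R.subring_is_ring by blast
  then show ?thesis
    by (simp add: free_alg_def)
qed

lemma const_in_free_alg: "c \<in> coeff_ring n \<Longrightarrow> const c \<in> carrier (free_alg n)"
  by (auto simp: mem_free_alg_iff const_def lookup_single when_def zero_word_def coeff_ring_0
      split: if_splits)

lemma gen_u_in_free_alg: "1 \<le> i \<Longrightarrow> i < j \<Longrightarrow> j \<le> n \<Longrightarrow> gen_u i j \<in> carrier (free_alg n)"
  by (auto simp: mem_free_alg_iff gen_u_def lookup_single when_def coeff_ring_0 coeff_ring_1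
      gens_def)

lemma gen_z_in_free_alg: "1 \<le> i \<Longrightarrow> i \<le> n \<Longrightarrow> gen_z i \<in> carrier (free_alg n)"
  by (auto simp: mem_free_alg_iff gen_z_def lookup_single when_def coeff_ring_0 coeff_ring_1
      gens_def)

lemma beta_in_coeff_ring: "beta \<in> coeff_ring n"
  unfolding coeff_ring_def by (rule generate_ring.incl) auto

lemma hpar_in_coeff_ring: "1 \<le> i \<Longrightarrow> i \<le> n \<Longrightarrow> hpar i \<in> coeff_ring n"
proof (cases "i = 1")
  case True
  then show ?thesis by (simp add: hpar_def coeff_ring_0)
next
  case False
  assume "1 \<le> i" "i \<le> n"
  with False show ?thesis
    unfolding coeff_ring_def by (intro generate_ring.incl) auto
qed

lemma qpar_in_coeff_ring: "1 \<le> i \<Longrightarrow> i < j \<Longrightarrow> j \<le> n \<Longrightarrow> qpar i j \<in> coeff_ring n"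
  unfolding coeff_ring_def by (rule generate_ring.incl) auto

lemma relators_subset: "relators n \<subseteq> carrier (free_alg n)"
proof -
  interpret F: ring "free_alg n" by (rule ring_free_alg)
  have add: "p + q \<in> carrier (free_alg n)"
    if "p \<in> carrier (free_alg n)" "q \<in> carrier (free_alg n)" for p q
    using F.a_closed[OF that] by (simp add: free_alg_def)
  have minus: "p - q \<in> carrier (free_alg n)"
    if "p \<in> carrier (free_alg n)" "q \<in> carrier (free_alg n)" for p q
  proof -
    have "- q \<in> carrier (free_alg n)"
      using that(2) by (auto simp: mem_free_alg_iff intro: coeff_ring_uminus)
    with add[OF that(1)] show ?thesis by force
  qed
  show ?thesis
    unfolding relators_def power2_eq_square
    by (auto intro!: minus add free_alg_mult_closed const_in_free_alg gen_u_in_free_alg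
        gen_z_in_free_alg beta_in_coeff_ring hpar_in_coeff_ring qpar_in_coeff_ring)
qed

lemma ideal_rel_ideal: "ideal (rel_ideal n) (free_alg n)"
  unfolding rel_ideal_def by (rule ring.genideal_ideal[OF ring_free_alg relators_subset])

lemma ring_HT: "ring (HT n)"
  unfolding HT_def by (rule ideal.quotient_is_ring[OF ideal_rel_ideal])

end

theory Submission
  imports Defs
begin

text \<open>
  Put \<open>w = 1 + t\<beta>\<close>, \<open>x\<^sub>i = 1 + z\<^sub>i\<close> and \<open>g\<^sub>j = h\<^sub>j - \<beta>\<close>. Then \<open>x\<^sub>i u\<^sub>i\<^sub>j = u\<^sub>i\<^sub>j x\<^sub>j + \<beta> x\<^sub>i + g\<^sub>j\<close>, so the
  shift by \<open>1\<close> in the Dunkl elements only changes the parameters. Put also \<open>u\<^sub>j\<^sub>i = \<beta> - u\<^sub>i\<^sub>j\<close> for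
  \<open>i < j\<close> and \<open>h\<^sub>i\<^sub>j = 1 + t u\<^sub>i\<^sub>j\<close> for all \<open>i \<noteq> j\<close>; then \<open>h\<^sub>i\<^sub>j h\<^sub>j\<^sub>i = 1 + t\<beta> - t\<^sup>2q\<^sub>i\<^sub>j\<close>, and the weights on
  the left-hand side turn the inverses of \<open>h\<^sub>i\<^sub>j\<close> that survive in a product of Dunkl elements into \<open>h\<^sub>j\<^sub>i\<close>.
  With the Yang-Baxter equation the summand of \<open>I\<close> becomes \<open>L\<^sub>I x\<^sub>I R\<^sub>I\<close>, where \<open>L\<^sub>I\<close> is an ordered
  product of the \<open>h\<^sub>a\<^sub>j\<close> with \<open>a \<in> I\<close>, \<open>j \<notin> I\<close>, \<open>j < a\<close>, and \<open>R\<^sub>I\<close> is one of those with \<open>j > a\<close>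
  (\<open>dunkl_product_normal_form\<close>).

  Let \<open>F\<^sub>m\<^sub>,\<^sub>k\<close> be the sum of these terms over the \<open>k\<close>-subsets of the first \<open>m\<close> indices. One more index \<open>s\<close>
  replaces \<open>x\<^sub>I\<close> by \<open>x\<^sub>I \<Prod>\<^sub>a h\<^sub>a\<^sub>s\<close> (\<open>a \<in> I\<close>) if \<open>s\<close> is not chosen, and by \<open>(\<Prod>\<^sub>j h\<^sub>s\<^sub>j) x\<^sub>I x\<^sub>s\<close> (\<open>j \<notin> I\<close>)
  if it is. The quadratic relation \<open>h\<^sub>a\<^sub>s h\<^sub>c\<^sub>s = h\<^sub>c\<^sub>s h\<^sub>a\<^sub>c + h\<^sub>c\<^sub>a h\<^sub>a\<^sub>s - w\<close> works like a partial fraction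
  decomposition in the variable with index \<open>s\<close>: each of these products is a constant plus a combination of
  terms that contain exactly one \<open>u\<^sub>a\<^sub>s\<close> (\<open>asc_prod_spectator\<close>, \<open>desc_prod_spectator\<close>), and the relation
  between \<open>x\<^sub>a\<close> and \<open>u\<^sub>a\<^sub>s\<close> trades \<open>x\<^sub>a\<close> for \<open>u\<^sub>a\<^sub>s x\<^sub>s + g\<^sub>s\<close> (\<open>x_spectator\<close>). The term of \<open>u\<^sub>a\<^sub>s\<close> that comes
  from \<open>I = J \<union> {a}\<close> and the one that comes from \<open>J\<close> consist of the same factors in two orders, which agree
  by Yang-Baxter (\<open>site_exchange\<close>), and have opposite signs. What remains is
  \<open>F\<^bsub>m+1,k+1\<^esub> = w\<^bsup>k+1\<^esup> F\<^bsub>m,k+1\<^esub> + F\<^bsub>m,k\<^esub> (w\<^bsup>m-k\<^esup> x\<^sub>s + t [m-k] g\<^sub>s)\<close> with \<open>[r] = 1 + w + \<dots> + w\<^bsup>r-1\<^esup>\<close>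
  (\<open>dunkl_sum_Suc\<close>). Sorting increasing sequences by whether they end in the last index gives the same
  recursion for the right-hand side (\<open>dunkl_sum_eq_lists\<close>).

  The computation takes place in an arbitrary type-class ring, with indices starting at \<open>0\<close>. The product of
  all ring structures on a type is such a ring, and the algebra of the theorem is one of its components; the
  generators are lifted to this product and the resulting identity is projected back.
\<close>

section \<open>Ordered products\<close>

text \<open>Products over the elements below \<open>m\<close> of an arbitrary set of indices, so that complements
  and unbounded intervals can be used directly as index sets. The sort omits \<open>0 \<noteq> 1\<close>, because the product
  of rings constructed below is trivial for a type with one element.\<close>

primrec asc_prod :: "nat set \<Rightarrow> (nat \<Rightarrow> 'a::{ring,monoid_mult}) \<Rightarrow> nat \<Rightarrow> 'a" where
  "asc_prod S f 0 = 1"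
| "asc_prod S f (Suc m) = asc_prod S f m * (if m \<in> S then f m else 1)"

primrec desc_prod :: "nat set \<Rightarrow> (nat \<Rightarrow> 'a::{ring,monoid_mult}) \<Rightarrow> nat \<Rightarrow> 'a" where
  "desc_prod S f 0 = 1"
| "desc_prod S f (Suc m) = (if m \<in> S then f m else 1) * desc_prod S f m"

lemma asc_prod_cong: "(\<And>i. i < m \<Longrightarrow> i \<in> S \<longleftrightarrow> i \<in> T) \<Longrightarrow> (\<And>i. i < m \<Longrightarrow> i \<in> S \<Longrightarrow> f i = f' i) \<Longrightarrow>
    asc_prod S f m = asc_prod T f' m"
  by (induction m) auto

lemma desc_prod_cong: "(\<And>i. i < m \<Longrightarrow> i \<in> S \<longleftrightarrow> i \<in> T) \<Longrightarrow> (\<And>i. i < m \<Longrightarrow> i \<in> S \<Longrightarrow> f i = f' i) \<Longrightarrow>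
    desc_prod S f m = desc_prod T f' m"
  by (induction m) auto

lemma asc_prod_eq_1: "(\<And>i. i < m \<Longrightarrow> i \<notin> S) \<Longrightarrow> asc_prod S f m = 1"
  by (induction m) auto

lemma desc_prod_eq_1: "(\<And>i. i < m \<Longrightarrow> i \<notin> S) \<Longrightarrow> desc_prod S f m = 1"
  by (induction m) auto

lemma below_Suc: "K \<inter> {..<Suc m} = (if m \<in> K then insert m (K \<inter> {..<m}) else K \<inter> {..<m})"
  by (auto simp: less_Suc_eq)

lemma commute_mult:
  fixes y :: "'a::semigroup_mult"
  shows "y * a = a * y \<Longrightarrow> y * c = c * y \<Longrightarrow> y * (a * c) = a * c * y"
  by (metis mult.assoc)

lemma asc_prod_commute: "(\<And>i. i < m \<Longrightarrow> i \<in> S \<Longrightarrow> y * f i = f i * y) \<Longrightarrow>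
    y * asc_prod S f m = asc_prod S f m * y"
  by (induction m) (auto intro: commute_mult)

lemma desc_prod_commute: "(\<And>i. i < m \<Longrightarrow> i \<in> S \<Longrightarrow> y * f i = f i * y) \<Longrightarrow>
    y * desc_prod S f m = desc_prod S f m * y"
  by (induction m) (auto intro: commute_mult)

lemma asc_prod_remove:
  assumes "a < m" "a \<in> S" "\<And>i. i < m \<Longrightarrow> i \<in> S \<Longrightarrow> f a * f i = f i * f a"
  shows "asc_prod S f m = f a * asc_prod (S - {a}) f m"
  using assms
proof (induction m)
  case (Suc m)
  show ?case
  proof (cases "a = m")
    case True
    have "asc_prod S f m = asc_prod (S - {a}) f m"
      by (rule asc_prod_cong) (use True in auto)
    moreover have "f a * asc_prod S f m = asc_prod S f m * f a"
      by (rule asc_prod_commute) (use Suc.prems True in auto)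
    ultimately show ?thesis using True Suc.prems by simp
  next
    case False
    then show ?thesis using Suc by (auto simp: mult.assoc)
  qed
qed simp

lemma asc_prod_split:
  "a < m \<Longrightarrow> asc_prod S f m = asc_prod (S \<inter> {..<a}) f m * (if a \<in> S then f a else 1)
      * asc_prod (S \<inter> {a<..}) f m"
proof (induction m)
  case (Suc m)
  show ?case
  proof (cases "a = m")
    case True
    have "asc_prod (S \<inter> {..<m}) f m = asc_prod S f m" by (rule asc_prod_cong) auto
    moreover have "asc_prod (S \<inter> {m<..}) f (Suc m) = 1" by (rule asc_prod_eq_1) auto
    ultimately show ?thesis using True by simp
  qed (use Suc in \<open>auto simp: mult.assoc\<close>)
qed simp

lemma desc_prod_split:
  "a < m \<Longrightarrow> desc_prod S f m = desc_prod (S \<inter> {a<..}) f m * (if a \<in> S then f a else 1)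
      * desc_prod (S \<inter> {..<a}) f m"
proof (induction m)
  case (Suc m)
  show ?case
  proof (cases "a = m")
    case True
    have "desc_prod (S \<inter> {..<m}) f m = desc_prod S f m" by (rule desc_prod_cong) auto
    moreover have "desc_prod (S \<inter> {m<..}) f (Suc m) = 1" by (rule desc_prod_eq_1) auto
    ultimately show ?thesis using True by simp
  qed (use Suc in \<open>auto simp: mult.assoc\<close>)
qed simp

lemma asc_prod_eq_prod_list: "asc_prod S f m = prod_list (map f (filter (\<lambda>i. i \<in> S) [0..<m]))"
  by (induction m) auto

lemma desc_prod_eq_prod_list: "desc_prod S f m = prod_list (map f (rev (filter (\<lambda>i. i \<in> S) [0..<m])))"
  by (induction m) auto

lemma asc_prod_eq_prod:
  fixes f :: "nat \<Rightarrow> 'a::comm_ring_1"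
  shows "asc_prod S f m = prod f (S \<inter> {..<m})"
  by (induction m) (auto simp: below_Suc mult.commute)

lemma desc_prod_eq_prod:
  fixes f :: "nat \<Rightarrow> 'a::comm_ring_1"
  shows "desc_prod S f m = prod f (S \<inter> {..<m})"
  by (induction m) (auto simp: below_Suc)

section \<open>Subsets and strictly increasing lists\<close>

lemma subsets_card_Suc:
  "{I. I \<subseteq> {..<Suc m} \<and> card I = Suc k}
    = {I. I \<subseteq> {..<m} \<and> card I = Suc k} \<union> insert m ` {J. J \<subseteq> {..<m} \<and> card J = k}" (is "?A = ?B \<union> ?C")
proof (intro equalityI subsetI)
  fix I assume I: "I \<in> ?A"
  show "I \<in> ?B \<union> ?C"
  proof (cases "m \<in> I")
    case True
    then have "I = insert m (I - {m})" "I - {m} \<subseteq> {..<m}" "card (I - {m}) = k"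
      using I by (auto simp: less_Suc_eq)
    then show ?thesis by blast
  qed (use I in \<open>auto simp: less_Suc_eq\<close>)
next
  fix I assume "I \<in> ?B \<union> ?C"
  then show "I \<in> ?A"
  proof
    assume "I \<in> ?C"
    then obtain J where J: "J \<subseteq> {..<m}" "card J = k" "I = insert m J" by auto
    then have "m \<notin> J" "finite J" by (auto intro: finite_subset)
    then show ?thesis using J by (auto simp: less_Suc_eq)
  qed (auto simp: less_Suc_eq)
qed

lemma sum_subsets_card_Suc:
  fixes f :: "nat set \<Rightarrow> 'b::comm_monoid_add"
  shows "(\<Sum>I \<in> {I. I \<subseteq> {..<Suc m} \<and> card I = Suc k}. f I)
    = (\<Sum>I \<in> {I. I \<subseteq> {..<m} \<and> card I = Suc k}. f I)
      + (\<Sum>J \<in> {J. J \<subseteq> {..<m} \<and> card J = k}. f (insert m J))"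
proof -
  have fin: "finite {I. I \<subseteq> {..<m} \<and> P I}" for P
    by (rule finite_subset[of _ "Pow {..<m}"]) auto
  have "inj_on (insert m) {J. J \<subseteq> {..<m} \<and> card J = k}"
    by (rule inj_onI) (metis (mono_tags, lifting) insert_ident lessThan_iff mem_Collect_eq
        nat_neq_iff subset_iff)
  then show ?thesis
    unfolding subsets_card_Suc using fin
    by (subst sum.union_disjoint) (auto simp: sum.reindex)
qed

definition strict_lists :: "nat \<Rightarrow> nat \<Rightarrow> nat list set" where
  "strict_lists n k = {is. length is = k \<and> sorted_wrt (<) is \<and> set is \<subseteq> {1..n}}"

lemma strict_lists_0: "strict_lists n 0 = {[]}"
  by (auto simp: strict_lists_def)

lemma finite_strict_lists: "finite (strict_lists n k)"
  by (rule finite_subset[OF _ finite_lists_length_eq[of "{1..n}" k]]) (auto simp: strict_lists_def)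

text \<open>There is room for the \<open>k - i - 1\<close> later entries between the entry at position \<open>i\<close>
  and \<open>n\<close>. Hence the exponents \<open>n + a - (k + m)\<close> of the right-hand side are not truncated.\<close>

lemma strict_lists_bound:
  "is \<in> strict_lists n k \<Longrightarrow> i < k \<Longrightarrow> is ! i + (k - Suc i) \<le> n"
proof (induction k arbitrary: "is" n)
  case (Suc k)
  obtain js l where "is": "is = js @ [l]"
    using Suc.prems by (cases "is" rule: rev_cases) (auto simp: strict_lists_def)
  have js: "js \<in> strict_lists (l - 1) k" and l: "1 \<le> l" "l \<le> n"
    using Suc.prems by (fastforce simp: strict_lists_def "is" sorted_wrt_append)+
  show ?case
  proof (cases "i = k")
    case True
    then show ?thesis using js l by (simp add: "is" nth_append strict_lists_def)
  next
    case False
    then have "js ! i + (k - Suc i) \<le> l - 1" using Suc js by auto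
    moreover have "is ! i = js ! i" using False Suc.prems js
        by (simp add: "is" nth_append strict_lists_def)
    ultimately show ?thesis using l False Suc.prems by simp
  qed
qed simp

lemma strict_lists_empty: "n < k \<Longrightarrow> strict_lists n k = {}"
proof (rule equals0I)
  fix "is" assume "n < k" and "is": "is \<in> strict_lists n k"
  then have "length is = card (set is)" by (auto simp: strict_lists_def strict_sorted_iff distinct_card)
  also have "\<dots> \<le> card {1..n}" by (rule card_mono) (use "is" in \<open>auto simp: strict_lists_def\<close>)
  finally show False using \<open>n < k\<close> "is" by (simp add: strict_lists_def)
qed

lemma strict_lists_Suc:
  "strict_lists (Suc n) (Suc k) = strict_lists n (Suc k) \<union> (\<lambda>js. js @ [Suc n]) ` strict_lists n k"
proof (intro equalityI subsetI)
  fix "is" assume "is": "is \<in> strict_lists (Suc n) (Suc k)"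
  then obtain js l where jl: "is = js @ [l]"
    by (cases "is" rule: rev_cases) (auto simp: strict_lists_def)
  have js: "js \<in> strict_lists (l - 1) k" and l: "1 \<le> l" "l \<le> Suc n"
    using "is" by (fastforce simp: strict_lists_def jl sorted_wrt_append)+
  show "is \<in> strict_lists n (Suc k) \<union> (\<lambda>js. js @ [Suc n]) ` strict_lists n k"
  proof (cases "l = Suc n")
    case True
    then show ?thesis using js jl by simp
  next
    case False
    have "set js \<subseteq> {1..n}" using js l by (fastforce simp: strict_lists_def)
    then have "is \<in> strict_lists n (Suc k)" using False l "is" by (auto simp: strict_lists_def jl)
    then show ?thesis by simp
  qed
next
  fix "is" assume "is \<in> strict_lists n (Suc k) \<union> (\<lambda>js. js @ [Suc n]) ` strict_lists n k"
  then show "is \<in> strict_lists (Suc n) (Suc k)"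
  proof
    assume "is \<in> (\<lambda>js. js @ [Suc n]) ` strict_lists n k"
    then show ?thesis by (auto simp: strict_lists_def sorted_wrt_append less_Suc_eq_le subset_iff)
  qed (auto simp: strict_lists_def subset_iff)
qed

lemma sum_strict_lists_Suc:
  fixes f :: "nat list \<Rightarrow> 'b::comm_monoid_add"
  shows "(\<Sum>is \<in> strict_lists (Suc n) (Suc k). f is)
    = (\<Sum>is \<in> strict_lists n (Suc k). f is) + (\<Sum>js \<in> strict_lists n k. f (js @ [Suc n]))"
proof -
  have "strict_lists n (Suc k) \<inter> (\<lambda>js. js @ [Suc n]) ` strict_lists n k = {}"
    by (auto simp: strict_lists_def)
  then show ?thesis
    unfolding strict_lists_Suc
    by (subst sum.union_disjoint) (auto simp: finite_strict_lists sum.reindex inj_on_def)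
qed

section \<open>Dunkl relations in a type-class ring\<close>

text \<open>The terms of degree \<open>2\<close> in \<open>t\<close> agree because \<open>b\<close> cancels in the difference of the two braid
  relations. In degree \<open>3\<close> both sides reduce to \<open>A C A - q B\<close>.\<close>

lemma yang_baxter:
  fixes A B C b t q :: "'a::{ring,monoid_mult}"
  assumes t: "\<And>y. y * t = t * y" and b: "\<And>y. y * b = b * y" and q: "\<And>y. y * q = q * y"
    and AC: "A * C = B * A + C * B - b * B" and CA: "C * A = A * B + B * C - b * B"
    and AA: "A * A = b * A + q"
  shows "(1 + t * A) * (1 + t * B) * (1 + t * C) = (1 + t * C) * (1 + t * B) * (1 + t * A)"
proof -
  have pull: "A * (t * y) = t * (A * y)" "B * (t * y) = t * (B * y)" "C * (t * y) = t * (C * y)" for y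
    by (metis t mult.assoc)+
  have "A * (B * C) = A * (C * A - A * B + b * B)"
    by (simp add: CA)
  also have "\<dots> = A * C * A - A * A * B + b * (A * B)"
    by (simp add: algebra_simps) (metis b mult.assoc)
  also have "\<dots> = A * C * A - q * B"
    by (simp add: AA algebra_simps)
  also have "\<dots> = (A * C - B * A + b * B) * A"
    by (simp add: algebra_simps AA) (metis b q mult.assoc)
  also have "\<dots> = C * (B * A)"
    by (simp add: AC algebra_simps)
  finally have cubic: "A * (B * C) = C * (B * A)" .
  have "A * B + A * C + B * C = C * B + C * A + B * A"
    by (simp add: AC CA)
  then have quad: "t * (t * (A * B)) + t * (t * (A * C)) + t * (t * (B * C))
    = t * (t * (C * B)) + t * (t * (C * A)) + t * (t * (B * A))"
    by (metis distrib_left)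
  show ?thesis
    using quad by (simp add: algebra_simps pull cubic)
qed

text \<open>Indices are called sites and are numbered from \<open>0\<close>. The relations are imposed for all
  pairs of sites, which spares every lemma a bound on its indices.\<close>

locale dunkl_algebra =
  fixes b t :: "'a::{ring,monoid_mult}" and u :: "nat \<Rightarrow> nat \<Rightarrow> 'a" and q :: "nat \<Rightarrow> nat \<Rightarrow> 'a"
    and x g :: "nat \<Rightarrow> 'a"
  assumes t_central: "y * t = t * y"
    and b_central: "y * b = b * y"
    and q_central: "y * q i j = q i j * y"
    and g_central: "y * g i = g i * y"
    and u_commute: "i < j \<Longrightarrow> k < l \<Longrightarrow> {i, j} \<inter> {k, l} = {} \<Longrightarrow> u i j * u k l = u k l * u i j"
    and u_braid: "i < j \<Longrightarrow> j < k \<Longrightarrow> u i j * u j k = u i k * u i j + u j k * u i k - b * u i k"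
    and u_braid': "i < j \<Longrightarrow> j < k \<Longrightarrow> u j k * u i j = u i j * u i k + u i k * u j k - b * u i k"
    and u_square: "i < j \<Longrightarrow> u i j * u i j = b * u i j + q i j"
    and x_commute: "x i * x j = x j * x i"
    and x_u_commute: "k < l \<Longrightarrow> i \<notin> {k, l} \<Longrightarrow> x i * u k l = u k l * x i"
    and x_u: "i < j \<Longrightarrow> x i * u i j = u i j * x j + b * x i + g j"
    and x_u': "i < j \<Longrightarrow> x j * u i j = u i j * x i - b * x i - g j"
begin

text \<open>With this extension of \<open>u\<close> to all pairs the braid relations hold for any order of the three
  indices, and \<open>h j i\<close> is \<open>kappa i j\<close> times the inverse of \<open>h i j\<close> (\<open>h_mult_flip\<close>).\<close>

definition uu :: "nat \<Rightarrow> nat \<Rightarrow> 'a" where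
  "uu i j = (if i < j then u i j else b - u j i)"

definition h :: "nat \<Rightarrow> nat \<Rightarrow> 'a" where
  "h i j = 1 + t * uu i j"

definition w :: 'a where "w = 1 + t * b"

definition kappa :: "nat \<Rightarrow> nat \<Rightarrow> 'a" where
  "kappa i j = w - t * t * q i j"

lemma central_left: "y * (t * z) = t * (y * z)" "y * (b * z) = b * (y * z)"
  "y * (g i * z) = g i * (y * z)" "y * (q i j * z) = q i j * (y * z)"
  by (metis t_central mult.assoc, metis b_central mult.assoc, metis g_central mult.assoc,
      metis q_central mult.assoc)

text \<open>Instances that move the central elements to the left past the generators and order them among
  each other; the general laws would make the simplifier loop.\<close>

lemmas pull =
  t_central[of b] t_central[of "u _ _"] t_central[of "x _"] t_central[of "q _ _"] t_central[of "g _"]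
  central_left(1)[of b] central_left(1)[of "u _ _"] central_left(1)[of "x _"]
  central_left(1)[of "q _ _"] central_left(1)[of "g _"]
  b_central[of "u _ _"] b_central[of "x _"] b_central[of "q _ _"] b_central[of "g _"]
  central_left(2)[of "u _ _"] central_left(2)[of "x _"] central_left(2)[of "q _ _"]
      central_left(2)[of "g _"]
  q_central[of "u _ _"] q_central[of "x _"] q_central[of "g _"]
  central_left(4)[of "u _ _"] central_left(4)[of "x _"] central_left(4)[of "g _"]
  g_central[of "u _ _"] g_central[of "x _"] central_left(3)[of "u _ _"] central_left(3)[of "x _"]

lemma w_central: "y * w = w * y"
  using commute_mult[OF t_central b_central, of y] by (simp add: w_def algebra_simps)

lemma w_pow_central: "y * w ^ r = w ^ r * y"
  by (induction r) (auto intro: commute_mult w_central)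

lemma kappa_central: "y * kappa i j = kappa i j * y"
  using w_central[of y] commute_mult[OF t_central commute_mult[OF t_central q_central], of y i j]
  by (simp add: kappa_def algebra_simps)

lemma uu_commute:
  assumes "i \<noteq> j" "k \<noteq> l" "{i, j} \<inter> {k, l} = {}"
  shows "uu i j * uu k l = uu k l * uu i j"
  using assms u_commute[of i j k l] u_commute[of j i k l] u_commute[of i j l k] u_commute[of j i l k]
  by (auto simp: uu_def algebra_simps pull)

lemma h_commute:
  assumes "i \<noteq> j" "k \<noteq> l" "{i, j} \<inter> {k, l} = {}"
  shows "h i j * h k l = h k l * h i j"
  using uu_commute[OF assms]
  by (simp add: h_def algebra_simps t_central[of "uu _ _"] central_left(1)[of "uu _ _"])

lemma u_h_commute: "i < j \<Longrightarrow> k \<noteq> l \<Longrightarrow> {i, j} \<inter> {k, l} = {} \<Longrightarrow> u i j * h k l = h k l * u i j"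
  using uu_commute[of i j k l] by (simp add: h_def uu_def[of i j] algebra_simps pull)

lemma x_h_commute: "k \<noteq> l \<Longrightarrow> i \<noteq> k \<Longrightarrow> i \<noteq> l \<Longrightarrow> x i * h k l = h k l * x i"
  using x_u_commute[of k l i] x_u_commute[of l k i]
  by (auto simp: h_def uu_def algebra_simps pull)

text \<open>Moving \<open>u i j\<close> past \<open>x j\<close> turns \<open>x j\<close> into \<open>x i\<close>, moving it past \<open>x i\<close> turns \<open>x i\<close> into \<open>x j\<close>, and
  the two corrections cancel.\<close>

lemma x_x_h_commute:
  assumes "i \<noteq> j" shows "x i * x j * h i j = h i j * (x i * x j)"
proof -
  have main: "x i * x j * u i j = u i j * (x i * x j)" if "i < j" for i j
  proof -
    have "x i * x j * u i j = x i * u i j * x i - b * (x i * x i) - g j * x i"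
      using that by (simp add: mult.assoc x_u' algebra_simps pull)
    also have "\<dots> = u i j * (x i * x j)"
      using that by (simp add: x_u algebra_simps x_commute[of j i])
    finally show ?thesis .
  qed
  show ?thesis
    using main[of i j] main[of j i] assms x_commute[of i j]
    by (auto simp: h_def uu_def algebra_simps pull not_less le_less)
qed

lemma h_mult_flip:
  assumes "i < j" shows "h i j * h j i = kappa i j" "h j i * h i j = kappa i j"
  using assms u_square[of i j]
  by (auto simp: h_def uu_def kappa_def w_def algebra_simps pull)

lemma yang_baxter_up:
  assumes "i < j" "j < k" shows "h i j * h i k * h j k = h j k * h i k * h i j"
  unfolding h_def uu_def using assms
  by (auto intro!: yang_baxter[where b=b and q="q i j"] t_central b_central q_central u_braid
      u_braid' u_square)

lemma yang_baxter_down: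
  assumes "i < j" "j < k" shows "h k j * h k i * h j i = h j i * h k i * h k j"
proof -
  have "(1 + t * (b - u j k)) * (1 + t * (b - u i k)) * (1 + t * (b - u i j))
      = (1 + t * (b - u i j)) * (1 + t * (b - u i k)) * (1 + t * (b - u j k))"
    using u_braid[OF assms] u_braid'[OF assms] u_square[OF assms(2)]
    by (intro yang_baxter[where b=b and q="q j k"] t_central b_central q_central)
       (simp_all add: algebra_simps pull)
  then show ?thesis using assms by (simp add: h_def uu_def)
qed

text \<open>The braid relations as straightening rules that bring \<open>h\<close> from the right of \<open>u\<close> to its left. In the
  first rule the new factor on the left does not depend on \<open>i\<close>, in the second one \<open>n\<close> occurs only once in
  each term of the result.\<close>

lemma u_h_up:
  assumes "i < p" "p < n" shows "u i n * h i p = h n p * u i n + t * (u i p * u p n)"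
  using assms arg_cong[OF u_braid[OF assms], of "(*) t"]
  by (simp add: h_def uu_def algebra_simps pull)

lemma u_h_down:
  assumes "a < c" "c < n" shows "u a n * h c n = h c a * u a n + t * (u c n * u a c)"
  using assms arg_cong[OF u_braid'[OF assms], of "(*) t"]
  by (simp add: h_def uu_def algebra_simps pull)

section \<open>Linear expansion in a spectator site\<close>

text \<open>The \<open>w\<close>-analogue of the number \<open>r\<close>.\<close>

definition geometric :: "nat \<Rightarrow> 'a" where "geometric r = (\<Sum>i<r. w ^ i)"

text \<open>The site \<open>n\<close> lies above all sites of the product. When the next site \<open>m\<close> is added,
  \<open>u_h_up\<close> turns the factor \<open>h a m\<close> in the summand of \<open>a\<close> into the common left factor \<open>h n m\<close>; the
  remainders form the same sum with \<open>m\<close> instead of \<open>n\<close>, and the induction hypothesis for \<open>m\<close> as the spectator evaluates it.\<close>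

lemma desc_prod_spectator:
  assumes "m \<le> n"
  shows "desc_prod K (h n) m = w ^ card (K \<inter> {..<m})
    - t * (\<Sum>a \<in> K \<inter> {..<m}. desc_prod (K \<inter> {..<a}) (h a) m * u a n * desc_prod (K \<inter> {a<..}) (h a) m)"
  using assms
proof (induction m arbitrary: n)
  case (Suc m)
  define S where "S n = (\<Sum>a \<in> K \<inter> {..<m}. desc_prod (K \<inter> {..<a}) (h a) m * u a n
      * desc_prod (K \<inter> {a<..}) (h a) m)" for n
  define c where "c = card (K \<inter> {..<m})"
  have IH: "desc_prod K (h n) m = w ^ c - t * S n" if "m \<le> n" for n
    using Suc.IH[OF that] by (simp add: S_def c_def)
  show ?case
  proof (cases "m \<in> K")
    case False
    then show ?thesis using IH[of n] Suc.prems by (simp add: below_Suc S_def c_def)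
  next
    case True
    have step: "desc_prod (K \<inter> {..<a}) (h a) (Suc m) * u a n * desc_prod (K \<inter> {a<..}) (h a) (Suc m)
       = h n m * (desc_prod (K \<inter> {..<a}) (h a) m * u a n * desc_prod (K \<inter> {a<..}) (h a) m)
         + t * (desc_prod (K \<inter> {..<a}) (h a) m * u a m * desc_prod (K \<inter> {a<..}) (h a) m * u m n)"
      if a: "a \<in> K \<inter> {..<m}" for a
    proof -
      let ?A = "desc_prod (K \<inter> {..<a}) (h a) m" and ?B = "desc_prod (K \<inter> {a<..}) (h a) m"
      have A: "h n m * ?A = ?A * h n m"
        by (rule desc_prod_commute) (rule h_commute, use a Suc.prems in auto)
      have B: "u m n * ?B = ?B * u m n"
        by (rule desc_prod_commute) (rule u_h_commute, use a Suc.prems in auto)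
      have "?A * u a n * (h a m * ?B) = ?A * (u a n * h a m) * ?B"
        by (simp add: mult.assoc)
      also have "\<dots> = ?A * h n m * u a n * ?B + t * (?A * u a m * (u m n * ?B))"
        using a Suc.prems by (simp add: u_h_up algebra_simps central_left(1)[of ?A])
      finally show ?thesis
        using a True by (simp add: A[symmetric] B mult.assoc)
    qed
    have "(\<Sum>a \<in> K \<inter> {..<m}. desc_prod (K \<inter> {..<a}) (h a) (Suc m) * u a n
        * desc_prod (K \<inter> {a<..}) (h a) (Suc m))
      = h n m * S n + t * (S m * u m n)"
      unfolding S_def sum_distrib_left sum_distrib_right sum.distrib[symmetric]
      by (rule sum.cong) (simp_all only: step)
    moreover have "desc_prod (K \<inter> {..<m}) (h m) (Suc m) * u m n * desc_prod (K \<inter> {m<..}) (h m) (Suc m)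
      = (w ^ c - t * S m) * u m n"
    proof -
      have "desc_prod (K \<inter> {..<m}) (h m) m = desc_prod K (h m) m" by (rule desc_prod_cong) auto
      moreover have "desc_prod (K \<inter> {m<..}) (h m) (Suc m) = 1" by (rule desc_prod_eq_1) auto
      ultimately show ?thesis by (simp add: IH)
    qed
    ultimately have total: "(\<Sum>a \<in> K \<inter> {..<Suc m}. desc_prod (K \<inter> {..<a}) (h a) (Suc m) * u a n
        * desc_prod (K \<inter> {a<..}) (h a) (Suc m))
      = h n m * S n + w ^ c * u m n"
      using True by (simp add: below_Suc algebra_simps)
    have "h n m = w - t * u m n"
      using Suc.prems by (simp add: h_def uu_def w_def algebra_simps)
    then have "h n m * w ^ c = w ^ Suc c - t * (w ^ c * u m n)"
      by (simp add: left_diff_distrib mult.assoc w_pow_central[of "u _ _"])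
    then have "h n m * (w ^ c - t * S n) = w ^ Suc c - t * (h n m * S n + w ^ c * u m n)"
      by (simp add: right_diff_distrib distrib_left central_left(1)[of "h _ _"])
    then show ?thesis
      using True Suc.prems by (simp only: total) (simp add: IH below_Suc c_def)
  qed
qed simp

text \<open>The constant terms that accompany the expansion of \<open>desc_prod_spectator\<close>. The sum over
  the first \<open>m + 1\<close> sites exceeds the one over \<open>m\<close> sites by terms that \<open>desc_prod_spectator\<close>, with
  \<open>m\<close> as the spectator, collapses to a power of \<open>w\<close>.\<close>

lemma desc_prod_gap_sum:
  "(\<Sum>a \<in> K \<inter> {..<m}. desc_prod (K \<inter> {..<a}) (h a) m * desc_prod (K \<inter> {a<..}) (h a) m)
    = geometric (card (K \<inter> {..<m}))"
proof (induction m)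
  case (Suc m)
  let ?A = "\<lambda>a. desc_prod (K \<inter> {..<a}) (h a) m" and ?B = "\<lambda>a. desc_prod (K \<inter> {a<..}) (h a) m"
  show ?case
  proof (cases "m \<in> K")
    case False
    then show ?thesis using Suc by (simp add: below_Suc)
  next
    case True
    have "(\<Sum>a \<in> K \<inter> {..<m}. desc_prod (K \<inter> {..<a}) (h a) (Suc m) * desc_prod (K \<inter> {a<..}) (h a) (Suc m))
      = (\<Sum>a \<in> K \<inter> {..<m}. ?A a * ?B a + t * (?A a * u a m * ?B a))"
      by (rule sum.cong)
         (use True in \<open>auto simp: h_def uu_def algebra_simps central_left(1)[of "desc_prod _ _ _"]\<close>)
    also have "\<dots> = geometric (card (K \<inter> {..<m})) + t * (\<Sum>a \<in> K \<inter> {..<m}. ?A a * u a m * ?B a)"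
      by (simp add: sum.distrib Suc sum_distrib_left)
    also have "\<dots> = geometric (card (K \<inter> {..<m})) + (w ^ card (K \<inter> {..<m}) - desc_prod K (h m) m)"
      by (simp add: desc_prod_spectator)
    finally have "(\<Sum>a \<in> K \<inter> {..<m}. desc_prod (K \<inter> {..<a}) (h a) (Suc m)
        * desc_prod (K \<inter> {a<..}) (h a) (Suc m))
      = geometric (Suc (card (K \<inter> {..<m}))) - desc_prod K (h m) m"
      by (simp add: geometric_def)
    moreover have "desc_prod (K \<inter> {..<m}) (h m) (Suc m) * desc_prod (K \<inter> {m<..}) (h m) (Suc m)
        = desc_prod K (h m) m"
    proof -
      have "desc_prod (K \<inter> {..<m}) (h m) m = desc_prod K (h m) m" by (rule desc_prod_cong) auto
      moreover have "desc_prod (K \<inter> {m<..}) (h m) (Suc m) = 1" by (rule desc_prod_eq_1) auto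
      ultimately show ?thesis by simp
    qed
    ultimately show ?thesis
      using True by (simp only: below_Suc) simp
  qed
qed (simp add: geometric_def)

text \<open>The counterpart of \<open>desc_prod_spectator\<close> for factors with \<open>n\<close> as their second index; the
  same induction works, with \<open>u_h_down\<close> as the straightening rule.\<close>

lemma asc_prod_spectator:
  assumes "m \<le> n"
  shows "asc_prod I (\<lambda>a. h a n) m = 1
    + t * (\<Sum>a \<in> I \<inter> {..<m}. asc_prod (I \<inter> {a<..}) (\<lambda>c. h c a) m * u a n
        * asc_prod (I \<inter> {..<a}) (\<lambda>c. h c a) m)"
  using assms
proof (induction m arbitrary: n)
  case (Suc m)
  let ?L = "\<lambda>a. asc_prod (I \<inter> {a<..}) (\<lambda>c. h c a) m" and ?R = "\<lambda>a. asc_prod (I \<inter> {..<a}) (\<lambda>c. h c a) m"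
  define S where "S n = (\<Sum>a \<in> I \<inter> {..<m}. ?L a * u a n * ?R a)" for n
  have IH: "asc_prod I (\<lambda>a. h a n) m = 1 + t * S n" if "m \<le> n" for n
    using Suc.IH[OF that] by (simp add: S_def)
  show ?case
  proof (cases "m \<in> I")
    case False
    then show ?thesis using IH[of n] Suc.prems by (simp add: below_Suc S_def)
  next
    case True
    have step: "?L a * u a n * ?R a * h m n
        = asc_prod (I \<inter> {a<..}) (\<lambda>c. h c a) (Suc m) * u a n * asc_prod (I \<inter> {..<a}) (\<lambda>c. h c a) (Suc m)
         + t * (u m n * (?L a * u a m * ?R a))"
      if a: "a \<in> I \<inter> {..<m}" for a
    proof -
      have L: "u m n * ?L a = ?L a * u m n"
        by (rule asc_prod_commute) (rule u_h_commute, use a Suc.prems in auto)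
      have R: "h m n * ?R a = ?R a * h m n"
        by (rule asc_prod_commute) (rule h_commute, use a Suc.prems in auto)
      have "?L a * u a n * ?R a * h m n = ?L a * (u a n * h m n) * ?R a"
        by (simp add: mult.assoc R)
      also have "\<dots> = ?L a * h m a * u a n * ?R a + t * (?L a * u m n * u a m * ?R a)"
        using a Suc.prems by (simp add: u_h_down algebra_simps central_left(1)[of "?L a"])
      finally show ?thesis
        using a True by (simp add: L[symmetric] mult.assoc)
    qed
    have "S n * h m n = (\<Sum>a \<in> I \<inter> {..<m}. asc_prod (I \<inter> {a<..}) (\<lambda>c. h c a) (Suc m) * u a n
        * asc_prod (I \<inter> {..<a}) (\<lambda>c. h c a) (Suc m))
      + t * (u m n * S m)"
      unfolding S_def sum_distrib_left sum_distrib_right sum.distrib[symmetric]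
      by (rule sum.cong) (simp_all only: step)
    moreover have "asc_prod (I \<inter> {m<..}) (\<lambda>c. h c m) (Suc m) * u m n
        * asc_prod (I \<inter> {..<m}) (\<lambda>c. h c m) (Suc m)
      = u m n + t * (u m n * S m)"
    proof -
      have "asc_prod (I \<inter> {..<m}) (\<lambda>c. h c m) m = asc_prod I (\<lambda>c. h c m) m" by (rule asc_prod_cong) auto
      moreover have "asc_prod (I \<inter> {m<..}) (\<lambda>c. h c m) (Suc m) = 1" by (rule asc_prod_eq_1) auto
      ultimately show ?thesis by (simp add: IH algebra_simps pull)
    qed
    ultimately have total: "(\<Sum>a \<in> I \<inter> {..<Suc m}. asc_prod (I \<inter> {a<..}) (\<lambda>c. h c a) (Suc m) * u a n
        * asc_prod (I \<inter> {..<a}) (\<lambda>c. h c a) (Suc m))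
      = S n * h m n + u m n"
      using True by (simp only: below_Suc) (simp add: algebra_simps)
    have "h m n = 1 + t * u m n"
      using Suc.prems by (simp add: h_def uu_def)
    then have "(1 + t * S n) * h m n = 1 + t * (S n * h m n + u m n)"
      by (simp add: algebra_simps)
    then show ?thesis
      using True Suc.prems by (simp only: total) (simp add: IH)
  qed
qed simp

lemma asc_prod_gap_sum:
  "(\<Sum>a \<in> I \<inter> {..<m}. asc_prod (I \<inter> {a<..}) (\<lambda>c. h c a) m * asc_prod (I \<inter> {..<a}) (\<lambda>c. h c a) m)
    = geometric (card (I \<inter> {..<m}))"
proof (induction m)
  case (Suc m)
  let ?L = "\<lambda>a. asc_prod (I \<inter> {a<..}) (\<lambda>c. h c a) m" and ?R = "\<lambda>a. asc_prod (I \<inter> {..<a}) (\<lambda>c. h c a) m"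
  show ?case
  proof (cases "m \<in> I")
    case False
    then show ?thesis using Suc by (simp add: below_Suc)
  next
    case True
    have "(\<Sum>a \<in> I \<inter> {..<m}. asc_prod (I \<inter> {a<..}) (\<lambda>c. h c a) (Suc m)
        * asc_prod (I \<inter> {..<a}) (\<lambda>c. h c a) (Suc m))
      = (\<Sum>a \<in> I \<inter> {..<m}. w * (?L a * ?R a) - t * (?L a * u a m * ?R a))"
      by (rule sum.cong)
         (use True in \<open>auto simp: h_def uu_def w_def algebra_simps central_left(1)[of "asc_prod _ _
             _"] central_left(2)[of "asc_prod _ _ _"]\<close>)
    also have "\<dots> = w * geometric (card (I \<inter> {..<m})) - t * (\<Sum>a \<in> I \<inter> {..<m}. ?L a * u a m * ?R a)"
      by (simp add: sum_subtractf Suc sum_distrib_left flip: Suc)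
    also have "\<dots> = w * geometric (card (I \<inter> {..<m})) + 1 - asc_prod I (\<lambda>c. h c m) m"
      by (simp add: asc_prod_spectator)
    also have "w * geometric (card (I \<inter> {..<m})) + 1 = geometric (Suc (card (I \<inter> {..<m})))"
      unfolding geometric_def sum.lessThan_Suc_shift by (simp add: sum_distrib_left add.commute)
    finally have "(\<Sum>a \<in> I \<inter> {..<m}. asc_prod (I \<inter> {a<..}) (\<lambda>c. h c a) (Suc m)
        * asc_prod (I \<inter> {..<a}) (\<lambda>c. h c a) (Suc m))
      = geometric (Suc (card (I \<inter> {..<m}))) - asc_prod I (\<lambda>c. h c m) m" .
    moreover have "asc_prod (I \<inter> {m<..}) (\<lambda>c. h c m) (Suc m)
        * asc_prod (I \<inter> {..<m}) (\<lambda>c. h c m) (Suc m) = asc_prod I (\<lambda>c. h c m) m"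
    proof -
      have "asc_prod (I \<inter> {..<m}) (\<lambda>c. h c m) m = asc_prod I (\<lambda>c. h c m) m" by (rule asc_prod_cong) auto
      moreover have "asc_prod (I \<inter> {m<..}) (\<lambda>c. h c m) (Suc m) = 1" by (rule asc_prod_eq_1) auto
      ultimately show ?thesis by simp
    qed
    ultimately show ?thesis
      using True by (simp only: below_Suc) simp
  qed
qed (simp add: geometric_def)

section \<open>Exchange of a chosen site and a removed one\<close>

text \<open>The factors on the left and on the right of the product of
  the \<open>x a\<close>, \<open>a \<in> I\<close>, in the normal form of the summand that belongs to \<open>I\<close>. Both grow at their inner end
  when a site is added, so that a new site only changes the middle of the summand.\<close>

primrec left_factor :: "nat \<Rightarrow> nat set \<Rightarrow> 'a" where
  "left_factor 0 I = 1"
| "left_factor (Suc m) I = (if m \<in> I then left_factor m I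
    * desc_prod (- I) (h m) m else left_factor m I)"

primrec right_factor :: "nat \<Rightarrow> nat set \<Rightarrow> 'a" where
  "right_factor 0 I = 1"
| "right_factor (Suc m) I = (if m \<in> I then right_factor m I else asc_prod I (\<lambda>a. h a m) m
    * right_factor m I)"

lemma left_factor_cong: "(\<And>i. i < m \<Longrightarrow> i \<in> I \<longleftrightarrow> i \<in> J) \<Longrightarrow> left_factor m I = left_factor m J"
proof (induction m)
  case (Suc m)
  then have "desc_prod (- I) (h m) m = desc_prod (- J) (h m) m" by (intro desc_prod_cong) auto
  then show ?case using Suc by auto
qed simp

lemma right_factor_cong: "(\<And>i. i < m \<Longrightarrow> i \<in> I \<longleftrightarrow> i \<in> J) \<Longrightarrow> right_factor m I = right_factor m J"
proof (induction m)
  case (Suc m)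
  then have "asc_prod I (\<lambda>a. h a m) m = asc_prod J (\<lambda>a. h a m) m" by (intro asc_prod_cong) auto
  then show ?case using Suc by auto
qed simp

lemma right_factor_commute:
  "(\<And>i j. i < j \<Longrightarrow> j < m \<Longrightarrow> i \<in> I \<Longrightarrow> j \<notin> I \<Longrightarrow> y * h i j = h i j * y) \<Longrightarrow>
      y * right_factor m I = right_factor m I * y"
  by (induction m) (auto intro!: commute_mult asc_prod_commute)

lemma yang_baxter_up_prod:
  assumes "a < p"
  shows "asc_prod (S \<inter> {..<a}) (\<lambda>c. h c a) m * asc_prod (S \<inter> {..<a}) (\<lambda>c. h c p) m * h a p
    = h a p * asc_prod (S \<inter> {..<a}) (\<lambda>c. h c p) m * asc_prod (S \<inter> {..<a}) (\<lambda>c. h c a) m"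
proof (induction m)
  case (Suc m)
  let ?P = "asc_prod (S \<inter> {..<a}) (\<lambda>c. h c a) m" and ?Q = "asc_prod (S \<inter> {..<a}) (\<lambda>c. h c p) m"
  show ?case
  proof (cases "m \<in> S \<inter> {..<a}")
    case True
    have Q: "h m a * ?Q = ?Q * h m a"
      by (rule asc_prod_commute, rule h_commute) (use True assms in auto)
    have P: "h m p * ?P = ?P * h m p"
      by (rule asc_prod_commute, rule h_commute) (use True assms in auto)
    have "?P * h m a * (?Q * h m p) * h a p = ?P * (h m a * ?Q) * h m p * h a p"
      by (simp only: mult.assoc)
    also have "\<dots> = ?P * ?Q * (h m a * h m p * h a p)"
      by (simp only: Q mult.assoc)
    also have "\<dots> = ?P * ?Q * (h a p * h m p * h m a)"
      using True assms by (simp add: yang_baxter_up)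
    also have "\<dots> = (?P * ?Q * h a p) * h m p * h m a"
      by (simp only: mult.assoc)
    also have "\<dots> = h a p * ?Q * (?P * h m p) * h m a"
      by (simp only: Suc) (simp only: mult.assoc)
    also have "\<dots> = h a p * (?Q * h m p) * (?P * h m a)"
      by (simp only: P[symmetric] mult.assoc)
    finally show ?thesis using True by simp
  qed (use Suc in auto)
qed simp

lemma yang_baxter_down_prod:
  assumes "a < p"
  shows "h p a * desc_prod (S \<inter> {..<a}) (h p) m * desc_prod (S \<inter> {..<a}) (h a) m
    = desc_prod (S \<inter> {..<a}) (h a) m * desc_prod (S \<inter> {..<a}) (h p) m * h p a"
proof (induction m)
  case (Suc m)
  let ?A = "desc_prod (S \<inter> {..<a}) (h a) m" and ?P = "desc_prod (S \<inter> {..<a}) (h p) m"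
  show ?case
  proof (cases "m \<in> S \<inter> {..<a}")
    case True
    have P: "h a m * ?P = ?P * h a m"
      by (rule desc_prod_commute, rule h_commute) (use True assms in auto)
    have A: "h p m * ?A = ?A * h p m"
      by (rule desc_prod_commute, rule h_commute) (use True assms in auto)
    have "h p a * (h p m * ?P) * (h a m * ?A) = h p a * h p m * (?P * h a m) * ?A"
      by (simp only: mult.assoc)
    also have "\<dots> = (h p a * h p m * h a m) * ?P * ?A"
      by (simp only: P[symmetric] mult.assoc)
    also have "\<dots> = (h a m * h p m * h p a) * ?P * ?A"
      using True assms by (simp add: yang_baxter_down)
    also have "\<dots> = h a m * h p m * (h p a * ?P * ?A)"
      by (simp only: mult.assoc)
    also have "\<dots> = h a m * (h p m * ?A) * ?P * h p a"
      by (simp only: Suc) (simp only: mult.assoc)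
    also have "\<dots> = (h a m * ?A) * (h p m * ?P) * h p a"
      by (simp only: A mult.assoc)
    finally show ?thesis using True by simp
  qed (use Suc in auto)
qed simp

text \<open>Adding \<open>a\<close> to \<open>J\<close> gives up the factors \<open>h c a\<close> with \<open>c \<in> J\<close> in exchange for the \<open>h a j\<close> with
  \<open>j \<notin> J\<close>. On each side of the equation the middle part restores the missing ones, and both sides are
  products of the same factors. The induction inserts one site at a time; the arbitrary \<open>y\<close> and
  \<open>\<phi>\<close> absorb the factors of the new site, after the Yang-Baxter equation has brought them to the middle.\<close>

lemma site_exchange:
  assumes "a < m" "a \<notin> J"
    and "\<And>i j. i < m \<Longrightarrow> j < m \<Longrightarrow> i \<notin> J \<Longrightarrow> j \<notin> J \<Longrightarrow> i \<noteq> j \<Longrightarrow> \<phi> * h i j = h i j * \<phi>"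
  shows "left_factor m (insert a J) * asc_prod (J \<inter> {a<..}) (\<lambda>c. h c a) m * y * \<phi>
        * asc_prod (J \<inter> {..<a}) (\<lambda>c. h c a) m * right_factor m (insert a J)
    = left_factor m J * desc_prod (- J \<inter> {..<a}) (h a) m * y * desc_prod (- J \<inter> {a<..}) (h a) m * \<phi>
        * right_factor m J"
  using assms
proof (induction m arbitrary: y \<phi>)
  case (Suc m)
  consider (eq) "a = m" | (out) "a < m" "m \<notin> J" | (inn) "a < m" "m \<in> J"
    using Suc.prems by linarith
  then show ?case
  proof cases
    case eq
    have "left_factor m (insert m J) = left_factor m J" "right_factor m (insert m J) = right_factor m J"
      by (auto intro: left_factor_cong right_factor_cong)
    moreover have "desc_prod (- insert m J) (h m) m = desc_prod (- J) (h m) m"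
      "desc_prod (- J \<inter> {..<m}) (h m) m = desc_prod (- J) (h m) m"
      "desc_prod (- J \<inter> {m<..}) (h m) m = 1"
      by (auto intro: desc_prod_cong desc_prod_eq_1)
    moreover have "asc_prod (J \<inter> {m<..}) (\<lambda>c. h c m) m = 1"
      "asc_prod (J \<inter> {..<m}) (\<lambda>c. h c m) m = asc_prod J (\<lambda>c. h c m) m"
      by (auto intro: asc_prod_cong asc_prod_eq_1)
    ultimately show ?thesis
      using eq Suc.prems by (simp add: mult.assoc)
  next
    case out
    let ?L = "asc_prod (J \<inter> {a<..}) (\<lambda>c. h c a) m" and ?R = "asc_prod (J \<inter> {..<a}) (\<lambda>c. h c a) m"
      and ?U = "asc_prod J (\<lambda>c. h c m) m" and ?U1 = "asc_prod (J \<inter> {..<a}) (\<lambda>c. h c m) m"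
      and ?U2 = "asc_prod (J \<inter> {a<..}) (\<lambda>c. h c m) m"
    have U: "?U = ?U1 * ?U2"
      using asc_prod_split[OF out(1), of J] Suc.prems by simp
    have "asc_prod (insert a J) (\<lambda>c. h c m) m = ?U1 * h a m * ?U2"
    proof -
      have "insert a J \<inter> {..<a} = J \<inter> {..<a}" "insert a J \<inter> {a<..} = J \<inter> {a<..}" by auto
      then show ?thesis using asc_prod_split[OF out(1), of "insert a J"] by simp
    qed
    then have "?R * asc_prod (insert a J) (\<lambda>c. h c m) m = ?R * ?U1 * h a m * ?U2"
      by (simp only: mult.assoc)
    also have "\<dots> = h a m * ?U1 * (?R * ?U2)"
      using yang_baxter_up_prod[OF out(1), of J m] by (simp only: mult.assoc)
    also have "?R * ?U2 = ?U2 * ?R"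
      by (rule asc_prod_commute, rule asc_prod_commute[symmetric], rule h_commute) (use out in auto)
    finally have R: "?R * asc_prod (insert a J) (\<lambda>c. h c m) m = h a m * ?U * ?R"
      by (simp only: U mult.assoc)
    have phi: "\<phi> * h a m = h a m * \<phi>"
      using Suc.prems out by auto
    have comm: "(\<phi> * ?U) * h i j = h i j * (\<phi> * ?U)"
      if "i < m" "j < m" "i \<notin> J" "j \<notin> J" "i \<noteq> j" for i j
    proof -
      have "h i j * ?U = ?U * h i j"
        by (rule asc_prod_commute, rule h_commute) (use that in auto)
      moreover have "\<phi> * h i j = h i j * \<phi>"
        using Suc.prems that by auto
      ultimately show ?thesis by (metis mult.assoc)
    qed
    have "left_factor (Suc m) (insert a J) * asc_prod (J \<inter> {a<..}) (\<lambda>c. h c a) (Suc m) * y * \<phi>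
        * asc_prod (J \<inter> {..<a}) (\<lambda>c. h c a) (Suc m) * right_factor (Suc m) (insert a J)
      = left_factor m (insert a J) * ?L * y * \<phi> * (?R * asc_prod (insert a J) (\<lambda>c. h c m) m)
          * right_factor m (insert a J)"
      using out by (simp add: mult.assoc)
    also have "\<dots> = left_factor m (insert a J) * ?L * y * (\<phi> * h a m) * ?U * ?R
        * right_factor m (insert a J)"
      by (simp only: R mult.assoc)
    also have "\<dots> = left_factor m (insert a J) * ?L * (y * h a m) * (\<phi> * ?U) * ?R
        * right_factor m (insert a J)"
      by (simp only: phi mult.assoc)
    also have "\<dots> = left_factor m J * desc_prod (- J \<inter> {..<a}) (h a) m * (y * h a m)
        * desc_prod (- J \<inter> {a<..}) (h a) m * (\<phi> * ?U) * right_factor m J"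
      by (rule Suc.IH) (use out Suc.prems comm in auto)
    finally show ?thesis
      using out by (simp add: mult.assoc)
  next
    case inn
    let ?L = "asc_prod (J \<inter> {a<..}) (\<lambda>c. h c a) m" and ?R = "asc_prod (J \<inter> {..<a}) (\<lambda>c. h c a) m"
      and ?A = "desc_prod (- J \<inter> {..<a}) (h a) m"
      and ?D = "desc_prod (- J) (h m) m" and ?D' = "desc_prod (- insert a J) (h m) m"
      and ?D1 = "desc_prod (- J \<inter> {..<a}) (h m) m" and ?D2 = "desc_prod (- J \<inter> {a<..}) (h m) m"
    have D: "?D = ?D2 * h m a * ?D1"
      using desc_prod_split[OF inn(1), of "- J"] Suc.prems by simp
    have D': "?D' = ?D2 * ?D1"
    proof -
      have "- insert a J \<inter> {..<a} = - J \<inter> {..<a}" "- insert a J \<inter> {a<..} = - J \<inter> {a<..}" by auto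
      then show ?thesis using desc_prod_split[OF inn(1), of "- insert a J"] by simp
    qed
    have "?D * ?A = ?D2 * (h m a * ?D1 * ?A)"
      by (simp only: D mult.assoc)
    also have "\<dots> = (?D2 * ?A) * ?D1 * h m a"
      by (simp only: yang_baxter_down_prod[OF inn(1)]) (simp only: mult.assoc)
    also have "?D2 * ?A = ?A * ?D2"
      by (rule desc_prod_commute, rule desc_prod_commute[symmetric], rule h_commute) (use inn in auto)
    finally have DA: "?D * ?A = ?A * ?D' * h m a"
      by (simp only: D' mult.assoc)
    have DL: "?D' * ?L = ?L * ?D'"
      by (rule asc_prod_commute, rule desc_prod_commute[symmetric], rule h_commute) (use inn in auto)
    have "left_factor (Suc m) (insert a J) * asc_prod (J \<inter> {a<..}) (\<lambda>c. h c a) (Suc m) * y * \<phi>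
        * asc_prod (J \<inter> {..<a}) (\<lambda>c. h c a) (Suc m) * right_factor (Suc m) (insert a J)
      = left_factor m (insert a J) * (?D' * ?L) * h m a * y * \<phi> * ?R * right_factor m (insert a J)"
      using inn by (simp add: mult.assoc)
    also have "\<dots> = left_factor m (insert a J) * ?L * (?D' * h m a * y) * \<phi> * ?R
        * right_factor m (insert a J)"
      by (simp only: DL mult.assoc)
    also have "\<dots> = left_factor m J * ?A * (?D' * h m a * y) * desc_prod (- J \<inter> {a<..}) (h a) m * \<phi>
        * right_factor m J"
      by (rule Suc.IH) (use inn Suc.prems in auto)
    also have "\<dots> = left_factor m J * (?A * ?D' * h m a) * y * desc_prod (- J \<inter> {a<..}) (h a) m * \<phi>
        * right_factor m J"
      by (simp only: mult.assoc)
    also have "\<dots> = left_factor m J * ?D * ?A * y * desc_prod (- J \<inter> {a<..}) (h a) m * \<phi>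
        * right_factor m J"
      by (simp only: DA[symmetric]) (simp only: mult.assoc)
    finally show ?thesis
      using inn by simp
  qed
qed simp

section \<open>Recursion for the sum over subsets\<close>

lemma w_power_eq: "w ^ r = 1 + t * b * geometric r"
proof (induction r)
  case (Suc r)
  have "w ^ Suc r = w ^ r + t * b * w ^ r" by (simp add: w_def distrib_right)
  then show ?case using Suc by (simp add: geometric_def distrib_left)
qed (simp add: geometric_def)

lemma x_asc_prod_commute: "x i * asc_prod S x m = asc_prod S x m * x i"
  by (rule asc_prod_commute) (rule x_commute)

lemma asc_prod_x_remove: "a < m \<Longrightarrow> a \<in> I \<Longrightarrow> asc_prod I x m = x a * asc_prod (I - {a}) x m"
  by (rule asc_prod_remove) (auto intro: x_commute)

lemma asc_prod_x_h_commute: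
  assumes "i \<noteq> j" and "i \<in> I \<longleftrightarrow> j \<in> I" "i < m" "j < m"
  shows "asc_prod I x m * h i j = h i j * asc_prod I x m"
proof (cases "i \<in> I")
  case True
  let ?X = "asc_prod (I - {i} - {j}) x m"
  have X: "asc_prod I x m = x i * x j * ?X"
    using asc_prod_x_remove[of i m I] asc_prod_x_remove[of j m "I - {i}"] True assms
        by (simp add: mult.assoc)
  have "h i j * ?X = ?X * h i j"
    by (rule asc_prod_commute, rule x_h_commute[symmetric]) (use assms in auto)
  then have "x i * x j * ?X * h i j = x i * x j * h i j * ?X"
    by (simp only: mult.assoc)
  then show ?thesis
    by (simp only: X x_x_h_commute[OF assms(1)]) (simp only: mult.assoc)
next
  case False
  show ?thesis
    by (rule asc_prod_commute[symmetric], rule x_h_commute[symmetric]) (use assms False in auto)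
qed

text \<open>All factors of \<open>asc_prod_spectator\<close> other than \<open>u a n\<close> commute with the product of the \<open>x\<close>. In front
  of \<open>u a n\<close>, the factor \<open>x a\<close> becomes \<open>u a n * x n + b * x a + g n\<close>. The terms with \<open>b\<close> complete
  \<open>1\<close> to a power of \<open>w\<close> by \<open>asc_prod_gap_sum\<close>.\<close>

lemma x_spectator:
  assumes "m \<le> n"
  shows "asc_prod I x m * asc_prod I (\<lambda>a. h a n) m = w ^ card (I \<inter> {..<m}) * asc_prod I x m
    + t * (\<Sum>a \<in> I \<inter> {..<m}. asc_prod (I \<inter> {a<..}) (\<lambda>c. h c a) m * (u a n * x n + g n)
        * asc_prod (I - {a}) x m * asc_prod (I \<inter> {..<a}) (\<lambda>c. h c a) m)"
proof -
  let ?X = "asc_prod I x m" and ?c = "card (I \<inter> {..<m})"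
  let ?L = "\<lambda>a. asc_prod (I \<inter> {a<..}) (\<lambda>c. h c a) m" and ?R = "\<lambda>a. asc_prod (I \<inter> {..<a}) (\<lambda>c. h c a) m"
  have step: "?X * (?L a * u a n * ?R a)
      = ?L a * (u a n * x n + g n) * asc_prod (I - {a}) x m * ?R a + b * (?X * (?L a * ?R a))"
    if a: "a \<in> I \<inter> {..<m}" for a
  proof -
    let ?Y = "asc_prod (I - {a}) x m"
    have XL: "?X * ?L a = ?L a * ?X"
      by (rule asc_prod_commute, rule asc_prod_x_h_commute) (use a in auto)
    have X: "?X = ?Y * x a"
      using asc_prod_x_remove[of a m I] a x_asc_prod_commute[of a "I - {a}"] by simp
    have Yu: "u a n * ?Y = ?Y * u a n"
      by (rule asc_prod_commute, rule x_u_commute[symmetric]) (use a assms in auto)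
    have "?X * u a n = ?Y * (u a n * x n + b * x a + g n)"
      using a assms by (simp add: X mult.assoc x_u)
    also have "\<dots> = ?Y * (u a n * x n) + b * ?X + ?Y * g n"
      by (simp only: X distrib_left central_left(2)[of ?Y])
    also have "\<dots> = (u a n * x n + g n) * ?Y + b * ?X"
      using commute_mult[OF Yu[symmetric] x_asc_prod_commute[symmetric]]
      by (simp only: g_central[of ?Y]) (simp add: distrib_right add_ac)
    finally have Xu: "?X * u a n = (u a n * x n + g n) * ?Y + b * ?X" .
    have "?X * (?L a * u a n * ?R a) = ?L a * (?X * u a n) * ?R a"
      by (simp only: mult.assoc[symmetric] XL)
    also have "\<dots> = ?L a * (u a n * x n + g n) * ?Y * ?R a + b * (?L a * ?X * ?R a)"
      by (simp only: Xu) (simp add: distrib_left distrib_right mult.assoc central_left(2)[of "?L a"])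
    finally show ?thesis
      by (simp only: XL[symmetric]) (simp only: mult.assoc)
  qed
  have "?X * (\<Sum>a \<in> I \<inter> {..<m}. ?L a * u a n * ?R a)
    = (\<Sum>a \<in> I \<inter> {..<m}. ?L a * (u a n * x n + g n) * asc_prod (I - {a}) x m * ?R a) + b * (?X
        * geometric ?c)"
    unfolding asc_prod_gap_sum[symmetric] sum_distrib_left sum.distrib[symmetric]
    by (rule sum.cong) (simp_all only: step)
  then have "?X * asc_prod I (\<lambda>a. h a n) m = ?X + t * b * (?X * geometric ?c)
    + t * (\<Sum>a \<in> I \<inter> {..<m}. ?L a * (u a n * x n + g n) * asc_prod (I - {a}) x m * ?R a)"
    using assms by (simp add: asc_prod_spectator distrib_left central_left(1)[of ?X] mult.assoc add_ac)
  also have "?X + t * b * (?X * geometric ?c) = ?X * w ^ ?c"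
    by (simp add: w_power_eq distrib_left central_left[of ?X] mult.assoc)
  finally show ?thesis by (simp only: w_pow_central)
qed

definition dunkl_sum :: "nat \<Rightarrow> nat \<Rightarrow> 'a" where
  "dunkl_sum m k = (\<Sum>I \<in> {I. I \<subseteq> {..<m} \<and> card I
      = k}. left_factor m I * asc_prod I x m * right_factor m I)"

text \<open>The summands without \<open>m\<close> are expanded by \<open>x_spectator\<close>, those with \<open>m\<close> by
  \<open>desc_prod_spectator\<close>. After \<open>site_exchange\<close> both expansions are expressed through the terms \<open>P J a y\<close>:
  the former contributes \<open>P J a (u a m * x m + g m)\<close>, the latter \<open>- P J a (u a m * x m)\<close>.\<close>

lemma dunkl_sum_Suc:
  assumes "k \<le> m"
  shows "dunkl_sum (Suc m) (Suc k) = w ^ Suc k * dunkl_sum m (Suc k)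
    + dunkl_sum m k * (w ^ (m - k) * x m + t * g m * geometric (m - k))"
proof -
  let ?A = "\<lambda>J a. desc_prod (- J \<inter> {..<a}) (h a) m" and ?B = "\<lambda>J a. desc_prod (- J \<inter> {a<..}) (h a) m"
  define P where "P J a y = left_factor m J * ?A J a * y * ?B J a * asc_prod J x m
      * right_factor m J" for J a y
  have rfac_Suc: "left_factor (Suc m) I * asc_prod I x (Suc m) * right_factor (Suc m) I
      = w ^ Suc k * (left_factor m I * asc_prod I x m * right_factor m I)
        + t * (\<Sum>a \<in> I. P (I - {a}) a (u a m * x m + g m))"
    if I: "I \<in> {I. I \<subseteq> {..<m} \<and> card I = Suc k}" for I
  proof -
    have "m \<notin> I" and Im: "I \<inter> {..<m} = I" using I by auto
    have sw: "left_factor m I * (asc_prod (I \<inter> {a<..}) (\<lambda>c. h c a) m * (u a m * x m + g m)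
        * asc_prod (I - {a}) x m * asc_prod (I \<inter> {..<a}) (\<lambda>c. h c a) m) * right_factor m I
      = P (I - {a}) a (u a m * x m + g m)" if a: "a \<in> I" for a
    proof -
      have sets: "(I - {a}) \<inter> {a<..} = I \<inter> {a<..}" "(I - {a}) \<inter> {..<a} = I \<inter> {..<a}"
        "insert a (I - {a}) = I"
        using a by auto
      have am: "a < m" "a \<notin> I - {a}" using I a by auto
      have comm: "asc_prod (I - {a}) x m * h i j = h i j * asc_prod (I - {a}) x m"
        if "i < m" "j < m" "i \<notin> I - {a}" "j \<notin> I - {a}" "i \<noteq> j" for i j
        by (rule asc_prod_x_h_commute) (use that in auto)
      have "left_factor m I * asc_prod (I \<inter> {a<..}) (\<lambda>c. h c a) m * (u a m * x m + g m)
        * asc_prod (I - {a}) x m * asc_prod (I \<inter> {..<a}) (\<lambda>c. h c a) m * right_factor m I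
            = P (I - {a}) a (u a m * x m + g m)"
        unfolding P_def by (rule site_exchange[of a m "I - {a}" "asc_prod (I - {a}) x m" "u a m
            * x m + g m", unfolded sets, OF am comm])
      then show ?thesis by (simp only: mult.assoc)
    qed
    have "left_factor (Suc m) I * asc_prod I x (Suc m) * right_factor (Suc m) I
      = left_factor m I * (asc_prod I x m * asc_prod I (\<lambda>a. h a m) m) * right_factor m I"
      using \<open>m \<notin> I\<close> by (simp add: mult.assoc)
    also have "\<dots> = w ^ Suc k * (left_factor m I * asc_prod I x m * right_factor m I) + t
        * (\<Sum>a\<in>I. left_factor m I * (asc_prod (I \<inter> {a<..}) (\<lambda>c. h c a) m * (u a m * x m + g m)
        * asc_prod (I - {a}) x m * asc_prod (I \<inter> {..<a}) (\<lambda>c. h c a) m) * right_factor m I)"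
    proof -
      have c: "card I = Suc k" using I by simp
      have e: "left_factor m I * (w ^ Suc k * asc_prod I x m + t * s) * right_factor m I
         = w ^ Suc k * (left_factor m I * asc_prod I x m * right_factor m I) + t * (left_factor m I
             * s * right_factor m I)" for s
        by (simp only: distrib_left distrib_right mult.assoc[symmetric] w_pow_central[of
            "left_factor m I"]
            t_central[of "left_factor m I"])
      show ?thesis
        unfolding x_spectator[OF order_refl] Im c e by (simp only: sum_distrib_left sum_distrib_right)
    qed
    also have "(\<Sum>a\<in>I. left_factor m I * (asc_prod (I \<inter> {a<..}) (\<lambda>c. h c a) m * (u a m * x m + g m)
        * asc_prod (I - {a}) x m * asc_prod (I \<inter> {..<a}) (\<lambda>c. h c a) m) * right_factor m I)
        = (\<Sum>a \<in> I. P (I - {a}) a (u a m * x m + g m))"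
      by (rule sum.cong) (simp_all only: sw)
    finally show ?thesis .
  qed
  have lfac_Suc: "left_factor (Suc m) (insert m J) * asc_prod (insert m J) x (Suc m)
      * right_factor (Suc m) (insert m J)
      = left_factor m J * asc_prod J x m * right_factor m J * (w ^ (m - k) * x m) - t
          * (\<Sum>a \<in> {..<m} - J. P J a (u a m * x m))"
    if J: "J \<in> {J. J \<subseteq> {..<m} \<and> card J = k}" for J
  proof -
    have x_rfac: "x m * right_factor m J = right_factor m J * x m"
      by (rule right_factor_commute, rule x_h_commute) auto
    have x_B: "x m * ?B J a = ?B J a * x m" if "a < m" for a
      by (rule desc_prod_commute, rule x_h_commute) (use that in auto)
    have Jm: "- J \<inter> {..<m} = {..<m} - J" by auto
    have card: "card ({..<m} - J) = m - k"
      using J by (auto simp: card_Diff_subset finite_subset[of J])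
    have P: "left_factor m J * (?A J a * u a m * ?B J a) * asc_prod J x m * x m * right_factor m J
        = P J a (u a m * x m)"
      if "a \<in> {..<m} - J" for a
    proof -
      have "P J a (u a m * x m) = left_factor m J * ?A J a * u a m * (x m * ?B J a) * asc_prod J x m
          * right_factor m J"
        by (simp only: P_def mult.assoc)
      also have "\<dots> = left_factor m J * ?A J a * u a m * ?B J a * (x m * asc_prod J x m)
          * right_factor m J"
        using that by (simp add: x_B mult.assoc)
      finally show ?thesis by (simp only: x_asc_prod_commute) (simp only: mult.assoc)
    qed
    have "desc_prod (- insert m J) (h m) m = desc_prod (- J) (h m) m" "asc_prod (insert m J) x m
        = asc_prod J x m"
      "left_factor m (insert m J) = left_factor m J" "right_factor m (insert m J) = right_factor m J"
      by (auto intro: desc_prod_cong asc_prod_cong left_factor_cong right_factor_cong)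
    then have "left_factor (Suc m) (insert m J) * asc_prod (insert m J) x (Suc m)
        * right_factor (Suc m) (insert m J)
      = left_factor m J * desc_prod (- J) (h m) m * asc_prod J x m * x m * right_factor m J"
      by (simp add: mult.assoc)
    also have "\<dots> = w ^ (m - k) * (left_factor m J * asc_prod J x m * x m * right_factor m J)
      - t * (left_factor m J * (\<Sum>a \<in> {..<m} - J. ?A J a * u a m * ?B J a) * asc_prod J x m * x m
          * right_factor m J)"
      unfolding desc_prod_spectator[OF order_refl] Jm card
      by (simp only: left_diff_distrib right_diff_distrib mult.assoc[symmetric] w_pow_central[of
          "left_factor m J"]
            t_central[of "left_factor m J"])
    also have "left_factor m J * asc_prod J x m * x m * right_factor m J
        = left_factor m J * asc_prod J x m * right_factor m J * x m"
      by (simp only: mult.assoc x_rfac)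
    also have "w ^ (m - k) * (left_factor m J * asc_prod J x m * right_factor m J * x m)
        = left_factor m J * asc_prod J x m * right_factor m J * (w ^ (m - k) * x m)"
      by (simp only: mult.assoc[symmetric] w_pow_central[of "left_factor m J * asc_prod J x m
          * right_factor m J"])
    also have "left_factor m J * (\<Sum>a \<in> {..<m} - J. ?A J a * u a m * ?B J a) * asc_prod J x m * x m
        * right_factor m J
      = (\<Sum>a \<in> {..<m} - J. P J a (u a m * x m))"
      unfolding sum_distrib_left sum_distrib_right by (rule sum.cong) (simp_all only: P)
    finally show ?thesis .
  qed
  have fin: "finite {I. I \<subseteq> {..<m} \<and> Q I}" for Q
    by (rule finite_subset[of _ "Pow {..<m}"]) auto
  \<comment> \<open>A set with a distinguished element is a smaller set together with an element outside it.\<close>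
  have reindex: "(\<Sum>I \<in> {I. I \<subseteq> {..<m} \<and> card I = Suc k}. \<Sum>a \<in> I. f (I - {a}) a)
    = (\<Sum>J \<in> {J. J \<subseteq> {..<m} \<and> card J = k}. \<Sum>a \<in> {..<m} - J. f J a)" for f :: "nat set \<Rightarrow> nat \<Rightarrow> 'a"
  proof -
    have "finite I" if "I \<subseteq> {..<m}" for I using that finite_subset by auto
    then show ?thesis using fin
      by (subst (1 2) sum.Sigma, auto)
         (rule sum.reindex_bij_witness[where i = "\<lambda>(J, a). (insert a J, a)" and j
             = "\<lambda>(I, a). (I - {a}, a)"],
          auto simp: insert_absorb card_insert_if card_Diff_singleton_if)
  qed
  have gsum: "(\<Sum>a \<in> {..<m} - J. P J a (g m))
      = left_factor m J * asc_prod J x m * right_factor m J * (g m * geometric (m - k))"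
    if J: "J \<in> {J. J \<subseteq> {..<m} \<and> card J = k}" for J
  proof -
    have Jm: "- J \<inter> {..<m} = {..<m} - J" by auto
    have card: "card ({..<m} - J) = m - k"
      using J by (auto simp: card_Diff_subset finite_subset[of J])
    have geometric_central: "y * geometric r = geometric r * y" for y r
      by (simp add: geometric_def sum_distrib_left sum_distrib_right w_pow_central)
    have "(\<Sum>a \<in> {..<m} - J. P J a (g m))
        = g m * (left_factor m J * (\<Sum>a \<in> {..<m} - J. ?A J a * ?B J a) * asc_prod J x m
        * right_factor m J)"
      unfolding sum_distrib_left sum_distrib_right P_def
      by (rule sum.cong) (simp_all only: mult.assoc central_left(3))
    also have "(\<Sum>a \<in> {..<m} - J. ?A J a * ?B J a) = geometric (m - k)"
      using desc_prod_gap_sum[of "- J" m] by (simp only: Jm card)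
    also have "g m * (left_factor m J * geometric (m - k) * asc_prod J x m * right_factor m J)
        = left_factor m J * asc_prod J x m * right_factor m J * (g m * geometric (m - k))"
    proof -
      have "left_factor m J * geometric (m - k) * asc_prod J x m * right_factor m J
          = left_factor m J * asc_prod J x m * right_factor m J * geometric (m - k)"
        using geometric_central[of "asc_prod J x m * right_factor m J" "m - k"]
            by (simp only: mult.assoc)
      then show ?thesis by (simp only: g_central[symmetric] mult.assoc)
    qed
    finally show ?thesis .
  qed
  have Padd: "P J a (y + z) = P J a y + P J a z" for J a y z
    by (simp only: P_def distrib_left distrib_right)
  let ?S = "{J. J \<subseteq> {..<m} \<and> card J = k}"
  have "dunkl_sum (Suc m) (Suc k) = w ^ Suc k * dunkl_sum m (Suc k)
      + t * (\<Sum>J \<in> ?S. \<Sum>a \<in> {..<m} - J. P J a (u a m * x m + g m))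
      + (\<Sum>J \<in> ?S. left_factor m J * asc_prod J x m * right_factor m J * (w ^ (m - k) * x m) - t
          * (\<Sum>a \<in> {..<m} - J. P J a (u a m * x m)))"
  proof -
    have "(\<Sum>I \<in> {I. I \<subseteq> {..<m} \<and> card I
        = Suc k}. left_factor (Suc m) I * asc_prod I x (Suc m) * right_factor (Suc m) I)
      = (\<Sum>I \<in> {I. I \<subseteq> {..<m} \<and> card I
          = Suc k}. w ^ Suc k * (left_factor m I * asc_prod I x m * right_factor m I)
        + t * (\<Sum>a \<in> I. P (I - {a}) a (u a m * x m + g m)))"
      by (rule sum.cong[OF refl rfac_Suc])
    also have "\<dots> = w ^ Suc k * dunkl_sum m (Suc k)
      + t * (\<Sum>J \<in> ?S. \<Sum>a \<in> {..<m} - J. P J a (u a m * x m + g m))"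
      by (simp only: sum.distrib sum_distrib_left dunkl_sum_def
        reindex[of "\<lambda>J a. t * P J a (u a m * x m + g m)"])
    finally have 1: "(\<Sum>I \<in> {I. I \<subseteq> {..<m} \<and> card I
        = Suc k}. left_factor (Suc m) I * asc_prod I x (Suc m) * right_factor (Suc m) I)
      = \<dots>" .
    show ?thesis
      unfolding dunkl_sum_def[of "Suc m"] sum_subsets_card_Suc 1
          by (rule arg_cong[OF sum.cong[OF refl lfac_Suc]])
  qed
  also have "\<dots> = w ^ Suc k * dunkl_sum m (Suc k) + dunkl_sum m k * (w ^ (m - k) * x m) + t
      * (\<Sum>J \<in> ?S. \<Sum>a \<in> {..<m} - J. P J a (g m))"
    by (simp add: Padd sum.distrib sum_subtractf dunkl_sum_def sum_distrib_right distrib_left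
        sum_distrib_left)
  also have "(\<Sum>J \<in> ?S. \<Sum>a \<in> {..<m} - J. P J a (g m)) = dunkl_sum m k * (g m * geometric (m - k))"
    unfolding dunkl_sum_def sum_distrib_right by (rule sum.cong) (simp_all only: gsum)
  finally show ?thesis
    by (simp add: distrib_left mult.assoc central_left(1) add.assoc)
qed

end

section \<open>Normal form of products of Dunkl elements\<close>

text \<open>The \<open>kappa i j\<close> are only invertible below \<open>N\<close>: sites beyond the
  actual algebra will be filled with \<open>u i j = b\<close> and \<open>q i j = 0\<close>, for which \<open>kappa i j = w\<close>.\<close>

locale dunkl_algebra_inv = dunkl_algebra +
  fixes kappa_inv :: "nat \<Rightarrow> nat \<Rightarrow> 'a" and N :: nat
  assumes kappa_inv_central: "y * kappa_inv i j = kappa_inv i j * y"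
    and kappa_kappa_inv: "i < j \<Longrightarrow> j < N \<Longrightarrow> kappa i j * kappa_inv i j = 1"
begin

definition dunkl_elt :: "nat \<Rightarrow> nat \<Rightarrow> 'a" where
  "dunkl_elt n i = desc_prod {..<i} (\<lambda>j. kappa_inv j i * h i j) i * x i * desc_prod {i<..} (h i) n"

definition weight :: "nat set \<Rightarrow> nat \<Rightarrow> 'a" where
  "weight I m = asc_prod I (\<lambda>i. desc_prod (- I) (\<lambda>j. kappa j i) i) m"

lemma kappa_prod_central: "y * desc_prod S (\<lambda>j. kappa j i) k = desc_prod S (\<lambda>j. kappa j i) k * y"
  by (rule desc_prod_commute) (rule kappa_central)

lemma weight_central: "y * weight I m = weight I m * y"
  unfolding weight_def by (rule asc_prod_commute) (rule kappa_prod_central)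

lemma h_prod_inverse: "k \<le> m \<Longrightarrow> m < N \<Longrightarrow>
    asc_prod S (\<lambda>j. h j m) k * desc_prod S (\<lambda>j. kappa_inv j m * h m j) k = 1"
proof (induction k)
  case (Suc k)
  have "h k m * (kappa_inv k m * h m k) = kappa k m * kappa_inv k m"
    using Suc.prems by (simp add: kappa_inv_central h_mult_flip mult.assoc[symmetric])
       (simp add: mult.assoc h_mult_flip kappa_inv_central)
  then have "h k m * (kappa_inv k m * h m k) = 1" using Suc.prems by (simp add: kappa_kappa_inv)
  then have "asc_prod S (\<lambda>j. h j m) k * (h k m * (kappa_inv k m * h m k))
      * desc_prod S (\<lambda>j. kappa_inv j m * h m j) k = 1"
    using Suc by simp
  then show ?case using Suc by (simp add: mult.assoc)
qed simp

lemma h_prod_flip: "k \<le> m \<Longrightarrow> desc_prod S (h m) k * asc_prod S (\<lambda>j. h j m) k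
    = desc_prod S (\<lambda>j. kappa j m) k"
proof (induction k)
  case (Suc k)
  have "h m k * (desc_prod S (h m) k * asc_prod S (\<lambda>j. h j m) k) * h k m
      = h m k * h k m * desc_prod S (\<lambda>j. kappa j m) k"
    using Suc by (simp add: mult.assoc kappa_prod_central)
  then have "h m k * (desc_prod S (h m) k * asc_prod S (\<lambda>j. h j m) k) * h k m
      = kappa k m * desc_prod S (\<lambda>j. kappa j m) k"
    using Suc.prems by (simp add: h_mult_flip)
  then have "h m k * desc_prod S (h m) k * (asc_prod S (\<lambda>j. h j m) k * h k m)
      = kappa k m * desc_prod S (\<lambda>j. kappa j m) k"
    by (simp only: mult.assoc)
  then show ?case using Suc by simp
qed simp

text \<open>The product of all \<open>h j s\<close> is the inverse of the left part of the Dunkl element of \<open>s\<close>. Passing it through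
  \<open>right_factor m I\<close> sorts its factors by membership in \<open>I\<close>. Read from right to left, this shows how
  the inverse factors \<open>h j s\<close> with \<open>j \<in> I\<close> cancel when the Dunkl elements of \<open>I\<close> are multiplied by that of
  \<open>s\<close>.\<close>

lemma right_factor_pass:
  "m \<le> s \<Longrightarrow> right_factor m I * asc_prod UNIV (\<lambda>j. h j s) m
      = asc_prod (- I) (\<lambda>j. h j s) m * asc_prod I (\<lambda>j. h j s) m * right_factor m I"
proof (induction m)
  case (Suc m)
  let ?R = "right_factor m I" and ?M = "asc_prod UNIV (\<lambda>j. h j s) m" and ?K
      = "asc_prod (- I) (\<lambda>j. h j s) m"
    and ?H = "asc_prod I (\<lambda>j. h j s) m" and ?P = "asc_prod I (\<lambda>a. h a m) m"
  have IH: "?R * ?M = ?K * ?H * ?R" using Suc by simp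
  have Rh: "h m s * ?R = ?R * h m s"
    by (rule right_factor_commute, rule h_commute) (use Suc.prems in auto)
  show ?case
  proof (cases "m \<in> I")
    case True
    have "?R * (?M * h m s) = ?K * ?H * (?R * h m s)"
      by (simp only: IH mult.assoc[symmetric])
    then show ?thesis using True by (simp add: Rh[symmetric] mult.assoc)
  next
    case False
    have PK: "?P * ?K = ?K * ?P"
      by (rule asc_prod_commute, rule asc_prod_commute[symmetric], rule h_commute) (use Suc.prems in
          auto)
    have ybe: "?P * ?H * h m s = h m s * ?H * ?P"
    proof -
      have "asc_prod I f m = asc_prod (I \<inter> {..<m}) f m" for f :: "nat \<Rightarrow> 'a" by (rule asc_prod_cong) auto
      then show ?thesis using yang_baxter_up_prod[of m s I m] Suc.prems by simp
    qed
    have "?P * ?R * (?M * h m s) = ?P * (?R * ?M) * h m s"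
      by (simp only: mult.assoc)
    also have "\<dots> = (?P * ?K) * ?H * (?R * h m s)"
      by (simp only: IH) (simp only: mult.assoc)
    also have "\<dots> = ?K * (?P * ?H * h m s) * ?R"
      by (simp only: PK Rh[symmetric]) (simp only: mult.assoc)
    also have "\<dots> = ?K * h m s * ?H * (?P * ?R)"
      by (simp only: ybe) (simp only: mult.assoc)
    finally show ?thesis using False by simp
  qed
qed simp

text \<open>The part of \<open>right_factor n I\<close> that belongs to sites above \<open>m\<close>. The inverses in the Dunkl element of
  \<open>m\<close> only interact with the remaining part.\<close>

primrec upper_factor :: "nat \<Rightarrow> nat set \<Rightarrow> nat \<Rightarrow> 'a" where
  "upper_factor m I 0 = 1"
| "upper_factor m I (Suc n) = (if m < n \<and> n \<notin> I then asc_prod I (\<lambda>a. h a n) n else 1)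
    * upper_factor m I n"

lemma upper_factor_commute:
  "(\<And>a i. a < i \<Longrightarrow> m < i \<Longrightarrow> i < n \<Longrightarrow> a \<in> I \<Longrightarrow> i \<notin> I \<Longrightarrow> y * h a i = h a i * y) \<Longrightarrow>
      y * upper_factor m I n = upper_factor m I n * y"
  by (induction n) (auto intro!: commute_mult asc_prod_commute)

lemma upper_factor_eq_1: "n \<le> Suc m \<Longrightarrow> upper_factor m I n = 1"
  by (induction n) auto

lemma right_factor_split:
  assumes "m < n"
  shows "right_factor n I = upper_factor m I n * right_factor (Suc m) I"
  using assms by (induction n) (auto simp: less_Suc_eq mult.assoc upper_factor_eq_1)

lemma upper_factor_insert:
  assumes "I \<subseteq> {..<m}"
  shows "upper_factor m (insert m I) n = upper_factor m I n * desc_prod {m<..} (h m) n"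
proof (induction n)
  case (Suc n)
  show ?case
  proof (cases "m < n")
    case True
    have "asc_prod (insert m I \<inter> {m<..}) (\<lambda>a. h a n) n = 1" by (rule asc_prod_eq_1) (use assms in auto)
    moreover have "asc_prod (insert m I \<inter> {..<m}) (\<lambda>a. h a n) n = asc_prod I (\<lambda>a. h a n) n"
      by (rule asc_prod_cong) (use assms in auto)
    ultimately have "asc_prod (insert m I) (\<lambda>a. h a n) n = asc_prod I (\<lambda>a. h a n) n * h m n"
      using asc_prod_split[OF True, of "insert m I" "\<lambda>a. h a n"] by simp
    moreover have "h m n * upper_factor m I n = upper_factor m I n * h m n"
      by (rule upper_factor_commute, rule h_commute) (use assms True in auto)
    moreover have "n \<notin> I" using assms True by auto
    ultimately show ?thesis
      using True Suc by (simp add: mult.assoc) (simp add: mult.assoc[symmetric])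
  qed (use Suc in auto)
qed simp

lemma left_factor_stable:
  assumes "I \<subseteq> {..<m}" "m \<le> n" shows "left_factor n I = left_factor m I"
  using assms(2) by (induction n rule: dec_induct) (use assms(1) in auto)

text \<open>The Dunkl element of the largest chosen site \<open>m\<close> is multiplied from the right. Its inverse factors meet the right factor of the
  smaller chosen sites; those of chosen sites cancel there by \<open>right_factor_pass\<close>, and the weight turns those
  of the other sites into \<open>h m j\<close>, which commute with everything down to the left factor.\<close>

lemma dunkl_product_normal_form:
  assumes "m \<le> n" "n \<le> N"
  shows "asc_prod I (dunkl_elt n) m * weight I m
      = left_factor n (I \<inter> {..<m}) * asc_prod I x m * right_factor n (I \<inter> {..<m})"
  using assms
proof (induction m)
  case 0
  have "left_factor n {} = 1" for n by (induction n) auto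
  moreover have "right_factor n {} = 1" for n by (induction n) (auto simp: asc_prod_eq_1)
  ultimately show ?case by (simp add: weight_def)
next
  case (Suc m)
  let ?J = "I \<inter> {..<m}"
  have J: "?J \<subseteq> {..<m}" "m \<notin> ?J" by auto
  show ?case
  proof (cases "m \<in> I")
    case False
    then show ?thesis using Suc by (simp add: below_Suc weight_def)
  next
    case True
    let ?X = "asc_prod I x m" and ?B = "desc_prod {m<..} (h m) n" and ?E
        = "desc_prod {..<m} (\<lambda>j. kappa_inv j m * h m j) m"
      and ?K = "desc_prod (- I) (\<lambda>j. kappa j m) m" and ?H = "desc_prod (- I) (h m) m"
      and ?C = "upper_factor m ?J n" and ?R = "right_factor m ?J" and ?L = "left_factor m ?J"
    have cut: "right_factor n ?J = ?C * (asc_prod ?J (\<lambda>a. h a m) m * ?R)"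
      using right_factor_split[of m n ?J] Suc.prems J by simp
    have "?R * asc_prod UNIV (\<lambda>j. h j m) m * ?E = ?R"
    proof -
      have "asc_prod UNIV (\<lambda>j. h j m) m = asc_prod {..<m} (\<lambda>j. h j m) m" by (rule asc_prod_cong) auto
      then show ?thesis using h_prod_inverse[of m m "{..<m}"] Suc.prems by (simp add: mult.assoc)
    qed
    then have "asc_prod (- ?J) (\<lambda>j. h j m) m * (asc_prod ?J (\<lambda>j. h j m) m * ?R * ?E) = ?R"
      by (simp add: right_factor_pass mult.assoc)
    then have "?H * asc_prod (- I) (\<lambda>j. h j m) m * (asc_prod ?J (\<lambda>j. h j m) m * ?R * ?E) = ?H * ?R"
    proof -
      have "asc_prod (- ?J) (\<lambda>j. h j m) m = asc_prod (- I) (\<lambda>j. h j m) m" by (rule asc_prod_cong) auto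
      then show ?thesis
        using \<open>asc_prod (- ?J) (\<lambda>j. h j m) m * (asc_prod ?J (\<lambda>j. h j m) m * ?R * ?E)
            = ?R\<close> by (simp add: mult.assoc)
    qed
    then have E: "asc_prod ?J (\<lambda>j. h j m) m * ?R * ?E * ?K = ?H * ?R"
      by (simp add: h_prod_flip kappa_prod_central[symmetric])
    have CH: "?C * ?H = ?H * ?C"
      by (rule desc_prod_commute, rule upper_factor_commute[symmetric], rule h_commute) auto
    have XH: "?X * ?H = ?H * ?X"
      by (rule desc_prod_commute, rule asc_prod_commute[symmetric], rule x_h_commute[symmetric]) auto
    have Rx: "x m * ?R = ?R * x m"
      by (rule right_factor_commute, rule x_h_commute) auto
    have Cx: "x m * ?C = ?C * x m"
      by (rule upper_factor_commute, rule x_h_commute) auto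
    have RB: "?R * ?B = ?B * ?R"
      by (rule desc_prod_commute, rule right_factor_commute[symmetric], rule h_commute) auto
    have L: "left_factor n ?J = ?L" "left_factor n (insert m ?J) = ?L * ?H"
    proof -
      show "left_factor n ?J = ?L" by (rule left_factor_stable) (use Suc.prems in auto)
      have "left_factor n (insert m ?J)
          = left_factor (Suc m) (insert m ?J)" by (rule left_factor_stable) (use Suc.prems in auto)
      moreover have "left_factor m (insert m ?J) = ?L" by (rule left_factor_cong) auto
      moreover have "desc_prod (- insert m ?J) (h m) m = ?H" by (rule desc_prod_cong) auto
      ultimately show "left_factor n (insert m ?J) = ?L * ?H" by simp
    qed
    have R: "right_factor n (insert m ?J) = ?C * ?B * ?R"
    proof -
      have "right_factor m (insert m ?J) = ?R" by (rule right_factor_cong) auto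
      then show ?thesis using right_factor_split[of m n "insert m ?J"] Suc.prems
          by (simp add: upper_factor_insert)
    qed
    have "asc_prod I (dunkl_elt n) (Suc m) * weight I (Suc m)
        = asc_prod I (dunkl_elt n) m * (dunkl_elt n m * weight I m) * ?K"
      using True by (simp add: weight_def mult.assoc)
    also have "\<dots> = (asc_prod I (dunkl_elt n) m * weight I m) * (?E * (x m * ?B * ?K))"
      by (simp only: weight_central[of "dunkl_elt n m"]) (simp only: dunkl_elt_def mult.assoc)
    also have "\<dots> = ?L * ?X * right_factor n ?J * (?E * (?K * (x m * ?B)))"
      using Suc by (simp only: kappa_prod_central[of "x m * ?B"] L)
    also have "\<dots> = ?L * ?X * ?C * (asc_prod ?J (\<lambda>j. h j m) m * ?R * ?E * ?K) * (x m * ?B)"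
      by (simp only: cut mult.assoc)
    also have "\<dots> = ?L * ?X * (?C * ?H) * (?R * x m) * ?B"
      by (simp only: E) (simp only: mult.assoc)
    also have "\<dots> = ?L * (?X * ?H) * ?C * x m * (?R * ?B)"
      by (simp only: CH Rx[symmetric]) (simp only: mult.assoc)
    also have "\<dots> = ?L * ?H * ?X * (?C * x m) * ?B * ?R"
      by (simp only: XH RB) (simp only: mult.assoc)
    also have "\<dots> = (?L * ?H) * (?X * x m) * (?C * ?B * ?R)"
      by (simp only: Cx[symmetric]) (simp only: mult.assoc)
    finally show ?thesis
      using True by (simp add: below_Suc L R)
  qed
qed

theorem dunkl_sum_eq_dunkl_elts:
  assumes "n \<le> N"
  shows "dunkl_sum n k = (\<Sum>I \<in> {I. I \<subseteq> {..<n} \<and> card I = k}. asc_prod I (dunkl_elt n) n * weight I n)"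
  unfolding dunkl_sum_def
proof (rule sum.cong[OF refl])
  fix I assume "I \<in> {I. I \<subseteq> {..<n} \<and> card I = k}"
  then have "I \<inter> {..<n} = I" by auto
  then show "left_factor n I * asc_prod I x n * right_factor n I
      = asc_prod I (dunkl_elt n) n * weight I n"
    using assms by (simp add: dunkl_product_normal_form)
qed

end

section \<open>Sum over increasing sequences\<close>

context dunkl_algebra begin

text \<open>The sequences have entries in \<open>{1..n}\<close> whereas sites start at \<open>0\<close>, hence \<open>m - 1\<close>.\<close>

definition rhs_factor :: "nat \<Rightarrow> nat \<Rightarrow> nat list \<Rightarrow> nat \<Rightarrow> 'a" where
  "rhs_factor n k is a = (let m = is ! (a - 1) in
     w ^ (n + a - (k + m)) * (x (m - 1) * w ^ (m - a) + t * g (m - 1) * geometric (m - a)))"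

lemma dunkl_sum_0: "dunkl_sum n 0 = 1"
proof -
  have "left_factor n {} = 1" by (induction n) auto
  moreover have "right_factor n {} = 1" by (induction n) (auto simp: asc_prod_eq_1)
  moreover have "{I. I \<subseteq> {..<n} \<and> card I = 0} = {{}}" by (auto simp: finite_subset[OF _ finite_lessThan])
  ultimately show ?thesis by (simp add: dunkl_sum_def asc_prod_eq_1)
qed

lemma dunkl_sum_eq_0: "n < k \<Longrightarrow> dunkl_sum n k = 0"
proof -
  assume "n < k"
  have "card I \<le> n" if "I \<subseteq> {..<n}" for I using card_mono[OF _ that] by simp
  with \<open>n < k\<close> have "{I. I \<subseteq> {..<n} \<and> card I = k} = {}" by (auto simp: not_le[symmetric])
  then show ?thesis by (simp only: dunkl_sum_def sum.empty)
qed

theorem dunkl_sum_eq_lists: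
  "dunkl_sum n k = (\<Sum>is \<in> strict_lists n k. prod_list (map (rhs_factor n k is) [1..<Suc k]))"
proof (induction n arbitrary: k)
  case 0
  show ?case by (cases k) (simp_all add: dunkl_sum_0 dunkl_sum_eq_0 strict_lists_0 strict_lists_empty)
next
  case (Suc n)
  show ?case
  proof (cases k)
    case 0
    then show ?thesis by (simp add: dunkl_sum_0 strict_lists_0)
  next
    case k: (Suc k')
    show ?thesis
    proof (cases "k' \<le> n")
      case False
      then show ?thesis using k by (simp add: dunkl_sum_eq_0 strict_lists_empty)
    next
      case True
      have scaled: "prod_list (map (\<lambda>a. w * f a) as)
          = w ^ length as * prod_list (map f as)" for f and as :: "nat list"
      proof (induction as)
        case (Cons a as)
        have "f a * (w ^ length as * prod_list (map f as))
            = w ^ length as * (f a * prod_list (map f as))"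
          by (simp add: w_pow_central[of "f a"] mult.assoc[symmetric])
        then show ?case using Cons by (simp add: mult.assoc)
      qed simp
      have old: "prod_list (map (rhs_factor (Suc n) (Suc k') is) [1..<Suc (Suc k')])
        = w ^ Suc k' * prod_list (map (rhs_factor n (Suc k') is) [1..<Suc (Suc k')])"
        if "is": "is \<in> strict_lists n (Suc k')" for "is"
      proof -
        have "rhs_factor (Suc n) (Suc k') is a
            = w * rhs_factor n (Suc k') is a" if "a \<in> set [1..<Suc (Suc k')]" for a
        proof -
          have "is ! (a - 1) + (Suc k' - a) \<le> n"
            using strict_lists_bound[OF "is", of "a - 1"] that by auto
          then have "Suc n + a - (Suc k' + is ! (a - 1)) = Suc (n + a - (Suc k' + is ! (a - 1)))"
            using that by auto
          then show ?thesis unfolding rhs_factor_def Let_def by (simp only: power_Suc mult.assoc)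
        qed
        then have "map (rhs_factor (Suc n) (Suc k') is) [1..<Suc (Suc k')]
          = map (\<lambda>a. w * rhs_factor n (Suc k') is a) [1..<Suc (Suc k')]"
          by (intro map_cong refl)
        then show ?thesis by (simp only: scaled length_upt) simp
      qed
      have new: "prod_list (map (rhs_factor (Suc n) (Suc k') (js @ [Suc n])) [1..<Suc (Suc k')])
        = prod_list (map (rhs_factor n k' js) [1..<Suc k']) * (w ^ (n - k') * x n + t * g n
            * geometric (n - k'))"
        if js: "js \<in> strict_lists n k'" for js
      proof -
        have len: "length js = k'" using js by (simp add: strict_lists_def)
        have "rhs_factor (Suc n) (Suc k') (js @ [Suc n]) a
            = rhs_factor n k' js a" if "a \<in> set [1..<Suc k']" for a
          using that len by (auto simp: rhs_factor_def nth_append Let_def)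
        then have "map (rhs_factor (Suc n) (Suc k') (js @ [Suc n])) [1..<Suc k']
            = map (rhs_factor n k' js) [1..<Suc k']"
          by (intro map_cong refl)
        moreover have "rhs_factor (Suc n) (Suc k') (js @ [Suc n]) (Suc k')
            = w ^ (n - k') * x n + t * g n * geometric (n - k')"
          using len by (simp add: rhs_factor_def nth_append w_pow_central[of "x n"])
        moreover have "[1..<Suc (Suc k')] = [1..<Suc k'] @ [Suc k']" by simp
        ultimately show ?thesis by (simp only: map_append prod_list.append list.map prod_list.Cons
            prod_list.Nil mult_1_right)
      qed
      show ?thesis
        unfolding k sum_strict_lists_Suc dunkl_sum_Suc[OF True] Suc.IH sum_distrib_left sum_distrib_right
        by (rule arg_cong2[where f = "(+)"]; rule sum.cong) (simp_all only: old new)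
    qed
  qed
qed

end

section \<open>Rings with a carrier as components of a type-class ring\<close>

text \<open>The product of all ring structures on a type. Through it,
  calculations in a ring given by a carrier can be carried out with type classes, although the carrier
  may depend on free variables.\<close>

typedef 'a ring_prod = "\<Pi>\<^sub>E R \<in> {R :: 'a ring. ring R}. carrier R"
proof -
  have "(\<lambda>R \<in> {R :: 'a ring. ring R}. \<zero>\<^bsub>R\<^esub>) \<in> (\<Pi>\<^sub>E R \<in> {R :: 'a ring. ring R}. carrier R)"
    by (auto intro: ring.ring_simprules)
  then show ?thesis by blast
qed

setup_lifting type_definition_ring_prod

lift_definition component :: "'a ring \<Rightarrow> 'a ring_prod \<Rightarrow> 'a" is "\<lambda>R f. f R" .

lemma component_closed: "ring R \<Longrightarrow> component R x \<in> carrier R"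
  by transfer auto

lemma ring_prod_eqI: "(\<And>R. ring R \<Longrightarrow> component R x = component R y) \<Longrightarrow> x = y"
  by transfer (auto intro: PiE_ext)

instantiation ring_prod :: (type) "{ring, monoid_mult}"
begin

lift_definition zero_ring_prod :: "'a ring_prod" is "\<lambda>R \<in> Collect ring. \<zero>\<^bsub>R\<^esub>"
  by (auto intro: ring.ring_simprules)

lift_definition one_ring_prod :: "'a ring_prod" is "\<lambda>R \<in> Collect ring. \<one>\<^bsub>R\<^esub>"
  by (auto intro: ring.ring_simprules)

lift_definition plus_ring_prod :: "'a ring_prod \<Rightarrow> 'a ring_prod \<Rightarrow> 'a ring_prod"
  is "\<lambda>f g. \<lambda>R \<in> Collect ring. f R \<oplus>\<^bsub>R\<^esub> g R"
  by (auto intro!: ring.ring_simprules dest: PiE_mem)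

lift_definition times_ring_prod :: "'a ring_prod \<Rightarrow> 'a ring_prod \<Rightarrow> 'a ring_prod"
  is "\<lambda>f g. \<lambda>R \<in> Collect ring. f R \<otimes>\<^bsub>R\<^esub> g R"
  by (auto intro!: ring.ring_simprules dest: PiE_mem)

lift_definition uminus_ring_prod :: "'a ring_prod \<Rightarrow> 'a ring_prod"
  is "\<lambda>f. \<lambda>R \<in> Collect ring. \<ominus>\<^bsub>R\<^esub> f R"
  by (auto intro!: ring.ring_simprules dest: PiE_mem)

definition minus_ring_prod :: "'a ring_prod \<Rightarrow> 'a ring_prod \<Rightarrow> 'a ring_prod" where
  "minus_ring_prod x y = x + - y"

lemma component_simps:
  fixes x y :: "'a ring_prod" and R :: "'a ring"
  assumes "ring R"
  shows "component R 0 = \<zero>\<^bsub>R\<^esub>" and "component R 1 = \<one>\<^bsub>R\<^esub>"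
    and "component R (x + y) = component R x \<oplus>\<^bsub>R\<^esub> component R y"
    and "component R (x * y) = component R x \<otimes>\<^bsub>R\<^esub> component R y"
    and "component R (- x) = \<ominus>\<^bsub>R\<^esub> component R x"
  using assms by (transfer; simp)+

instance
proof
  fix x y z :: "'a ring_prod"
  note rules = component_simps component_closed
    ring.ring_simprules(7-12) monoid.r_one[OF ring.is_monoid]
    ring.ring_simprules(13) ring.ring_simprules(23)
  show "x + y + z = x + (y + z)" "x + y = y + x" "0 + x = x" "- x + x = 0"
    "x * y * z = x * (y * z)" "1 * x = x" "x * 1 = x"
    "(x + y) * z = x * z + y * z" "x * (y + z) = x * y + x * z"
    by (rule ring_prod_eqI; simp add: rules)+
  show "x - y = x + - y"
    by (simp add: minus_ring_prod_def)
qed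

end

context
  fixes R :: "'a ring"
  assumes R: "ring R"
begin

lemma component_prod_list: "component R (prod_list xs) = list_prod R (map (component R) xs)"
  by (induction xs) (simp_all add: list_prod_def component_simps[OF R])

lemma component_sum: "component R (sum f A) = (\<Oplus>\<^bsub>R\<^esub> a \<in> A. component R (f a))"
proof -
  interpret ring R by (rule R)
  show ?thesis
    by (induction A rule: infinite_finite_induct)
       (simp_all add: component_simps[OF R] component_closed[OF R] Pi_def)
qed

end

text \<open>The embedding of one factor of the product. It preserves sums and products, but sends \<open>\<one>\<close> to an
  idempotent instead of \<open>1\<close>.\<close>

lift_definition embed :: "'a ring \<Rightarrow> 'a \<Rightarrow> 'a ring_prod"
  is "\<lambda>R a. \<lambda>S \<in> Collect ring. if S = R \<and> a \<in> carrier R then a else \<zero>\<^bsub>S\<^esub>"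
  by (auto intro: ring.ring_simprules)

lemma component_embed:
  "ring S \<Longrightarrow> component S (embed R a) = (if S = R \<and> a \<in> carrier R then a else \<zero>\<^bsub>S\<^esub>)"
  by transfer simp

lemma embed_hom:
  assumes "ring R" "a \<in> carrier R" "c \<in> carrier R"
  shows "embed R (a \<oplus>\<^bsub>R\<^esub> c) = embed R a + embed R c"
    and "embed R (a \<otimes>\<^bsub>R\<^esub> c) = embed R a * embed R c"
    and "embed R (\<ominus>\<^bsub>R\<^esub> a) = - embed R a"
  using assms
proof -
  interpret R: ring R by (rule assms)
  show "embed R (a \<oplus>\<^bsub>R\<^esub> c) = embed R a + embed R c" "embed R (a \<otimes>\<^bsub>R\<^esub> c) = embed R a * embed R c"
    "embed R (\<ominus>\<^bsub>R\<^esub> a) = - embed R a"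
    using assms by (auto intro!: ring_prod_eqI simp: component_simps component_embed
      ring.ring_simprules(2,8,21,24))
qed

section \<open>Coefficients\<close>

lemma par_nonzero: "par v \<noteq> 0"
proof -
  have "Poly_Mapping.single (Poly_Mapping.single v (1::nat)) (1::int) \<noteq> 0"
    by (metis lookup_single_eq lookup_zero zero_neq_one)
  then show ?thesis by (simp add: par_def eq_fract Zero_fract_def)
qed

text \<open>The constant term of the polynomial is \<open>1\<close>.\<close>

lemma kap_nonzero: "kap i j \<noteq> 0"
proof -
  let ?X = "\<lambda>v. Poly_Mapping.single (Poly_Mapping.single v (1::nat)) (1::int)"
  let ?P = "1 + ?X Pbeta * ?X Pt - (?X Pt)\<^sup>2 * ?X (Pq (min i j) (max i j))"
  have ne: "Poly_Mapping.single v (1::nat) + m \<noteq> 0" for v and m :: "param \<Rightarrow>\<^sub>0 nat"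
  proof
    assume "Poly_Mapping.single v (1::nat) + m = 0"
    then have "Poly_Mapping.lookup (Poly_Mapping.single v (1::nat) + m) v = 0" by simp
    then show False by (simp add: lookup_add lookup_single)
  qed
  have "Poly_Mapping.lookup ?P 0 = 1"
    using ne by (simp add: power2_eq_square mult_single lookup_add lookup_minus lookup_single
        when_def lookup_one add.assoc)
  then have "?P \<noteq> 0" by (metis lookup_zero zero_neq_one)
  moreover have "kap i j = Fract ?P 1"
    by (simp add: kap_def par_def qpar_def power2_eq_square One_fract_def)
  ultimately show ?thesis by (simp add: eq_fract Zero_fract_def)
qed

text \<open>The coefficients lie in a field, so it is enough to compare both sides after multiplication by
  \<open>\<beta>\<close>, which is a nonzero element.\<close>

lemma power_quot_eq: "power_quot m = tpar * (\<Sum>i<m. (1 + tpar * beta) ^ i)"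
proof -
  have "beta * power_quot m = (\<Sum>r = 1..m. of_nat (m choose r) * (tpar * beta) ^ r)"
    unfolding power_quot_def sum_distrib_left
  proof (rule sum.cong[OF refl])
    fix r assume "r \<in> {1..m}"
    then have "beta * beta ^ (r - 1) = beta ^ r" by (cases r) auto
    then show "beta * (of_nat (m choose r) * tpar ^ r * beta ^ (r - 1))
        = of_nat (m choose r) * (tpar * beta) ^ r"
      by (simp add: power_mult_distrib mult_ac)
  qed
  also have "\<dots> = (\<Sum>r\<le>m. of_nat (m choose r) * (tpar * beta) ^ r) - 1"
    by (simp add: atMost_atLeast0 sum.atLeast_Suc_atMost)
  also have "(\<Sum>r\<le>m. of_nat (m choose r) * (tpar * beta) ^ r) = (1 + tpar * beta) ^ m"
    using binomial_ring[of "tpar * beta" 1 m] by (simp add: add.commute)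
  also have "\<dots> - 1 = beta * (tpar * (\<Sum>i<m. (1 + tpar * beta) ^ i))"
    by (simp add: power_diff_1_eq mult_ac)
  finally show ?thesis using par_nonzero[of Pbeta] by simp
qed

lemma const_simps: "const (c + d) = const c + const d" "const (c * d) = const c * const d" "const 1 = 1"
  "const 0 = 0"
  by (simp_all add: const_def single_add mult_single)

lemma const_commute: "p * const c = const c * p"
proof (induction p rule: update_induct)
  case (update f a v)
  have "Poly_Mapping.update a v f = f + Poly_Mapping.single a v"
    using update by (intro poly_mapping_eqI) (auto
        simp: lookup_update lookup_add lookup_single when_def in_keys_iff)
  then show ?case using update.IH
    by (simp add: distrib_left distrib_right const_def mult_single mult.commute)
qed simp

lemma tpar_in_coeff_ring: "tpar \<in> coeff_ring n"
  unfolding coeff_ring_def by (rule generate_ring.incl) auto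

lemma coeff_ring_diff: "a \<in> coeff_ring n \<Longrightarrow> c \<in> coeff_ring n \<Longrightarrow> a - c \<in> coeff_ring n"
  using coeff_ring_add[OF _ coeff_ring_uminus, of a n c] by simp

lemma kap_in_coeff_ring:
  assumes "1 \<le> i" "i < j" "j \<le> n"
  shows "kap i j \<in> coeff_ring n" "inverse (kap i j) \<in> coeff_ring n"
proof -
  show "kap i j \<in> coeff_ring n" unfolding kap_def power2_eq_square
    using assms by (intro coeff_ring_add coeff_ring_diff coeff_ring_1 coeff_ring_mult beta_in_coeff_ring
      tpar_in_coeff_ring qpar_in_coeff_ring)
  show "inverse (kap i j) \<in> coeff_ring n" unfolding coeff_ring_def
    by (rule generate_ring.incl) (use assms in auto)
qed

lemma coeff_ring_power: "a \<in> coeff_ring n \<Longrightarrow> a ^ r \<in> coeff_ring n"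
  by (induction r) (auto intro: coeff_ring_1 coeff_ring_mult)

section \<open>Lifting the algebra to the product of rings\<close>

lemma free_alg_ops:
  "monoid.mult (free_alg n) = (*)" "ring.add (free_alg n) = (+)" "monoid.one (free_alg n) = 1"
  by (simp_all add: free_alg_def)

lemma cls_hom: "cls n \<in> ring_hom (free_alg n) (HT n)"
  using ideal.rcos_ring_hom[OF ideal_rel_ideal[of n]] by (simp add: cls_def[abs_def] HT_def)

lemma cls_relator:
  assumes "r \<in> relators n" shows "cls n r = \<zero>\<^bsub>HT n\<^esub>"
proof -
  interpret ideal "rel_ideal n" "free_alg n" by (rule ideal_rel_ideal)
  have "r \<in> rel_ideal n"
    unfolding rel_ideal_def using ring.genideal_self[OF ring_free_alg relators_subset] assms by blast
  then show ?thesis by (simp add: cls_def HT_def FactRing_def a_rcos_const)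
qed

definition lift_cls :: "nat \<Rightarrow> nc_poly \<Rightarrow> nc_poly set ring_prod" where
  "lift_cls n p = embed (HT n) (cls n p)"

lemma cls_closed: "p \<in> carrier (free_alg n) \<Longrightarrow> cls n p \<in> carrier (HT n)"
  by (rule ring_hom_closed[OF cls_hom])

lemma component_lift_cls: "p \<in> carrier (free_alg n) \<Longrightarrow> component (HT n) (lift_cls n p) = cls n p"
  by (simp add: lift_cls_def component_embed ring_HT cls_closed)

lemma free_alg_add: "p \<in> carrier (free_alg n) \<Longrightarrow> r \<in> carrier (free_alg n) \<Longrightarrow> p + r \<in> carrier (free_alg n)"
  using ring.ring_simprules(1)[OF ring_free_alg, of p n r] by (simp add: free_alg_ops)

lemma free_alg_uminus: "p \<in> carrier (free_alg n) \<Longrightarrow> - p \<in> carrier (free_alg n)"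
  by (auto simp: mem_free_alg_iff intro: coeff_ring_uminus)

lemma free_alg_minus: "p \<in> carrier (free_alg n) \<Longrightarrow> r \<in> carrier (free_alg n) \<Longrightarrow>
    p - r \<in> carrier (free_alg n)"
  using free_alg_add[OF _ free_alg_uminus, of p n r] by simp

lemma lift_cls_hom:
  assumes "p \<in> carrier (free_alg n)" "r \<in> carrier (free_alg n)"
  shows "lift_cls n (p + r) = lift_cls n p + lift_cls n r" and "lift_cls n (p * r)
      = lift_cls n p * lift_cls n r"
    and "lift_cls n (p - r) = lift_cls n p - lift_cls n r"
proof -
  have add: "lift_cls n (p + r) = lift_cls n p + lift_cls n r"
    if "p \<in> carrier (free_alg n)" "r \<in> carrier (free_alg n)" for p r
    using ring_hom_add[OF cls_hom that] that
    by (simp add: lift_cls_def embed_hom[OF ring_HT] cls_closed free_alg_ops flip: embed_hom)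
  show "lift_cls n (p + r) = lift_cls n p + lift_cls n r" by (rule add) fact+
  show "lift_cls n (p * r) = lift_cls n p * lift_cls n r"
    using ring_hom_mult[OF cls_hom assms] assms
    by (simp add: lift_cls_def embed_hom[OF ring_HT] cls_closed free_alg_ops)
  have "lift_cls n (p - r) + lift_cls n r = lift_cls n p"
    using add[of "p - r" r] assms by (simp add: free_alg_minus)
  then show "lift_cls n (p - r) = lift_cls n p - lift_cls n r" by (simp add: eq_diff_eq)
qed

lemma lift_cls_relation:
  assumes "p - r \<in> relators n" "p \<in> carrier (free_alg n)" "r \<in> carrier (free_alg n)"
  shows "lift_cls n p = lift_cls n r"
proof -
  have "lift_cls n (p - r) = 0"
    by (rule ring_prod_eqI) (simp add: lift_cls_def component_embed component_simps cls_relator[OF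
        assms(1)])
  then show ?thesis using assms by (simp add: lift_cls_hom)
qed

lemma lift_cls_const_central:
  assumes "c \<in> coeff_ring n" shows "y * lift_cls n (const c) = lift_cls n (const c) * y"
proof (rule ring_prod_eqI)
  fix R :: "nc_poly set ring" assume R: "ring R"
  show "component R (y * lift_cls n (const c)) = component R (lift_cls n (const c) * y)"
  proof (cases "R = HT n")
    case True
    obtain p where p: "p \<in> carrier (free_alg n)" "component R y = cls n p"
      using component_closed[OF R, of y] True
      by (auto simp: HT_def FactRing_def A_RCOSETS_def' cls_def)
    have "cls n p \<otimes>\<^bsub>HT n\<^esub> cls n (const c) = cls n (const c) \<otimes>\<^bsub>HT n\<^esub> cls n p"
      using ring_hom_mult[OF cls_hom, of p n "const c"] ring_hom_mult[OF cls_hom, of "const c" n p]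
        p const_in_free_alg[OF assms] by (simp add: free_alg_ops const_commute)
    then show ?thesis
      using True R p const_in_free_alg[OF assms] by (simp add: component_simps component_lift_cls)
  next
    case False
    then show ?thesis
      using R by (simp add: component_simps lift_cls_def component_embed component_closed
          ring.ring_simprules)
  qed
qed

lemma relator_z_z:
  assumes "1 \<le> i" "i \<le> n" "1 \<le> j" "j \<le> n"
  shows "gen_z i * gen_z j - gen_z j * gen_z i \<in> relators n"
  unfolding relators_def
  by (rule UnI1, rule UnI1, rule UnI1, rule UnI1, rule UnI1, rule UnI1, rule UnI1, rule CollectI,
      intro exI conjI, rule refl) (fact assms)+

lemma relator_u_u:
  assumes "1 \<le> i" "i < j" "j \<le> n" "1 \<le> k" "k < l" "l \<le> n" "{i, j} \<inter> {k, l} = {}"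
  shows "gen_u i j * gen_u k l - gen_u k l * gen_u i j \<in> relators n"
  unfolding relators_def
  by (rule UnI1, rule UnI1, rule UnI1, rule UnI1, rule UnI1, rule UnI1, rule UnI2, rule CollectI,
      intro exI conjI, rule refl) (fact assms)+

lemma relator_braid:
  assumes "1 \<le> i" "i < j" "j < k" "k \<le> n"
  shows "gen_u i j * gen_u j k - (gen_u i k * gen_u i j + gen_u j k * gen_u i k - const beta
      * gen_u i k) \<in> relators n"
  unfolding relators_def
  by (rule UnI1, rule UnI1, rule UnI1, rule UnI1, rule UnI1, rule UnI2, rule CollectI,
      intro exI conjI, rule refl) (fact assms)+

lemma relator_braid':
  assumes "1 \<le> i" "i < j" "j < k" "k \<le> n"
  shows "gen_u j k * gen_u i j - (gen_u i j * gen_u i k + gen_u i k * gen_u j k - const beta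
      * gen_u i k) \<in> relators n"
  unfolding relators_def
  by (rule UnI1, rule UnI1, rule UnI1, rule UnI1, rule UnI2, rule CollectI,
      intro exI conjI, rule refl) (fact assms)+

lemma relator_square:
  assumes "1 \<le> i" "i < j" "j \<le> n"
  shows "(gen_u i j)\<^sup>2 - const beta * gen_u i j - const (qpar i j) \<in> relators n"
  unfolding relators_def
  by (rule UnI1, rule UnI1, rule UnI1, rule UnI2, rule CollectI,
      intro exI conjI, rule refl) (fact assms)+

lemma relator_z_u:
  assumes "1 \<le> i" "i \<le> n" "1 \<le> k" "k < l" "l \<le> n" "i \<notin> {k, l}"
  shows "gen_z i * gen_u k l - gen_u k l * gen_z i \<in> relators n"
  unfolding relators_def
  by (rule UnI1, rule UnI1, rule UnI2, rule CollectI, intro exI conjI, rule refl) (fact assms)+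

lemma relator_z_left:
  assumes "1 \<le> i" "i < j" "j \<le> n"
  shows "gen_z i * gen_u i j - (gen_u i j * gen_z j + const beta * gen_z i
      + const (hpar j)) \<in> relators n"
  unfolding relators_def
  by (rule UnI1, rule UnI2, rule CollectI, intro exI conjI, rule refl) (fact assms)+

lemma relator_z_right:
  assumes "1 \<le> i" "i < j" "j \<le> n"
  shows "gen_z j * gen_u i j - (gen_u i j * gen_z i - const beta
      * gen_z i - const (hpar j)) \<in> relators n"
  unfolding relators_def
  by (rule UnI2, rule CollectI, intro exI conjI, rule refl) (fact assms)+

text \<open>The generators are lifted to the product of rings so that the relations hold for all sites. Sites
  \<open>j \<ge> n\<close> get \<open>u i j = \<beta>\<close>, \<open>q i j = 0\<close>, \<open>z j = 0\<close> and \<open>h j = 0\<close>; these values satisfy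
  every relation.\<close>

locale ht_lift =
  fixes n :: nat
begin

abbreviation b :: "nc_poly set ring_prod" where "b \<equiv> lift_cls n (const beta)"
abbreviation t :: "nc_poly set ring_prod" where "t \<equiv> lift_cls n (const tpar)"

definition u :: "nat \<Rightarrow> nat \<Rightarrow> nc_poly set ring_prod" where
  "u i j = (if j < n then lift_cls n (gen_u (Suc i) (Suc j)) else b)"

definition q :: "nat \<Rightarrow> nat \<Rightarrow> nc_poly set ring_prod" where
  "q i j = (if i < j \<and> j < n then lift_cls n (const (qpar (Suc i) (Suc j))) else 0)"

definition z :: "nat \<Rightarrow> nc_poly set ring_prod" where
  "z i = (if i < n then lift_cls n (gen_z (Suc i)) else 0)"

definition h_lift :: "nat \<Rightarrow> nc_poly set ring_prod" where
  "h_lift i = (if i < n then lift_cls n (const (hpar (Suc i))) else 0)"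

text \<open>The lift of a scalar that is \<open>1\<close> in all other components, as is required for inverses and for
  powers of \<open>w\<close>.\<close>

definition unital_scal :: "param_field \<Rightarrow> nc_poly set ring_prod" where
  "unital_scal c = 1 + lift_cls n (const (c - 1))"

definition kappa_inv :: "nat \<Rightarrow> nat \<Rightarrow> nc_poly set ring_prod" where
  "kappa_inv i j = (if i < j \<and> j < n then unital_scal (inverse (kap (Suc i) (Suc j))) else 1)"

lemmas in_free_alg = const_in_free_alg gen_u_in_free_alg gen_z_in_free_alg free_alg_mult_closed
    free_alg_add free_alg_minus
  beta_in_coeff_ring tpar_in_coeff_ring hpar_in_coeff_ring qpar_in_coeff_ring

lemma b_central: "y * b = b * y"
  by (rule lift_cls_const_central) (rule beta_in_coeff_ring)

lemma t_central: "y * t = t * y"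
  by (rule lift_cls_const_central) (rule tpar_in_coeff_ring)

lemma q_central: "y * q i j = q i j * y"
  by (simp add: q_def lift_cls_const_central qpar_in_coeff_ring)

lemma h_lift_central: "y * h_lift i = h_lift i * y"
  by (simp add: h_lift_def lift_cls_const_central hpar_in_coeff_ring)

lemma u_commute:
  assumes "i < j" "k < l" "{i, j} \<inter> {k, l} = {}"
  shows "u i j * u k l = u k l * u i j"
proof (cases "j < n \<and> l < n")
  case True
  have "lift_cls n (gen_u (Suc i) (Suc j) * gen_u (Suc k) (Suc l))
      = lift_cls n (gen_u (Suc k) (Suc l) * gen_u (Suc i) (Suc j))"
    by (rule lift_cls_relation, rule relator_u_u) (use assms True in \<open>simp_all add: in_free_alg\<close>)
  then show ?thesis using assms True by (simp add: u_def lift_cls_hom in_free_alg)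
qed (auto simp: u_def b_central[of "lift_cls n (gen_u _ _)"] b_central[of "lift_cls n (gen_z _)"])

lemma u_braid:
  assumes "i < j" "j < k"
  shows "u i j * u j k = u i k * u i j + u j k * u i k - b * u i k"
proof (cases "k < n")
  case True
  let ?u = "\<lambda>i j. gen_u (Suc i) (Suc j)"
  have "lift_cls n (?u i j * ?u j k)
      = lift_cls n (?u i k * ?u i j + ?u j k * ?u i k - const beta * ?u i k)"
    by (rule lift_cls_relation, rule relator_braid) (use assms True in \<open>simp_all add: in_free_alg\<close>)
  then show ?thesis using assms True by (simp add: u_def lift_cls_hom in_free_alg)
qed (use assms in \<open>auto simp: u_def b_central[of "lift_cls n (gen_u _ _)"]\<close>)

lemma u_braid':
  assumes "i < j" "j < k"
  shows "u j k * u i j = u i j * u i k + u i k * u j k - b * u i k"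
proof (cases "k < n")
  case True
  let ?u = "\<lambda>i j. gen_u (Suc i) (Suc j)"
  have "lift_cls n (?u j k * ?u i j)
      = lift_cls n (?u i j * ?u i k + ?u i k * ?u j k - const beta * ?u i k)"
    by (rule lift_cls_relation, rule relator_braid') (use assms True in \<open>simp_all add: in_free_alg\<close>)
  then show ?thesis using assms True by (simp add: u_def lift_cls_hom in_free_alg)
qed (use assms in \<open>auto simp: u_def b_central[of "lift_cls n (gen_u _ _)"]\<close>)

lemma u_square:
  assumes "i < j" shows "u i j * u i j = b * u i j + q i j"
proof (cases "j < n")
  case True
  let ?u = "gen_u (Suc i) (Suc j)"
  have "lift_cls n (?u * ?u) = lift_cls n (const beta * ?u + const (qpar (Suc i) (Suc j)))"
    using relator_square[of "Suc i" "Suc j" n] assms True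
    by (intro lift_cls_relation) (simp_all add: power2_eq_square diff_diff_eq in_free_alg)
  then show ?thesis using assms True by (simp add: u_def q_def lift_cls_hom in_free_alg)
qed (auto simp: u_def q_def)

lemma z_commute: "z i * z j = z j * z i"
proof (cases "i < n \<and> j < n")
  case True
  have "lift_cls n (gen_z (Suc i) * gen_z (Suc j)) = lift_cls n (gen_z (Suc j) * gen_z (Suc i))"
    by (rule lift_cls_relation, rule relator_z_z) (use True in \<open>simp_all add: in_free_alg\<close>)
  then show ?thesis using True by (simp add: z_def lift_cls_hom in_free_alg)
qed (auto simp: z_def)

lemma z_u_commute:
  assumes "k < l" "i \<notin> {k, l}" shows "z i * u k l = u k l * z i"
proof (cases "i < n \<and> l < n")
  case True
  have "lift_cls n (gen_z (Suc i) * gen_u (Suc k) (Suc l))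
      = lift_cls n (gen_u (Suc k) (Suc l) * gen_z (Suc i))"
    by (rule lift_cls_relation, rule relator_z_u) (use assms True in \<open>simp_all add: in_free_alg\<close>)
  then show ?thesis using assms True by (simp add: z_def u_def lift_cls_hom in_free_alg)
qed (auto simp: z_def u_def b_central[of "lift_cls n (gen_u _ _)"] b_central[of "lift_cls n (gen_z _)"])

lemma z_u:
  assumes "i < j" shows "z i * u i j = u i j * z j + b * z i + h_lift j"
proof (cases "j < n")
  case True
  have "lift_cls n (gen_z (Suc i) * gen_u (Suc i) (Suc j))
    = lift_cls n (gen_u (Suc i) (Suc j) * gen_z (Suc j) + const beta * gen_z (Suc i)
        + const (hpar (Suc j)))"
    by (rule lift_cls_relation, rule relator_z_left) (use assms True in \<open>simp_all add: in_free_alg\<close>)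
  then show ?thesis using assms True by (simp add: z_def u_def h_lift_def lift_cls_hom in_free_alg)
qed (auto simp: z_def u_def h_lift_def b_central[of "lift_cls n (gen_z _)"])

lemma z_u':
  assumes "i < j" shows "z j * u i j = u i j * z i - b * z i - h_lift j"
proof (cases "j < n")
  case True
  have "lift_cls n (gen_z (Suc j) * gen_u (Suc i) (Suc j))
    = lift_cls n (gen_u (Suc i) (Suc j) * gen_z (Suc i) - const beta
        * gen_z (Suc i) - const (hpar (Suc j)))"
    by (rule lift_cls_relation, rule relator_z_right) (use assms True in \<open>simp_all add: in_free_alg\<close>)
  then show ?thesis using assms True by (simp add: z_def u_def h_lift_def lift_cls_hom in_free_alg)
qed (auto simp: z_def u_def h_lift_def b_central[of "lift_cls n (gen_z _)"])

sublocale dunkl_algebra b t u q "\<lambda>i. 1 + z i" "\<lambda>i. h_lift i - b"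
proof
  fix i j k l :: nat and y :: "nc_poly set ring_prod"
  show "y * (h_lift i - b) = (h_lift i - b) * y"
    by (simp add: algebra_simps b_central[of y] h_lift_central[of y])
  show "(1 + z i) * (1 + z j) = (1 + z j) * (1 + z i)"
    by (simp add: algebra_simps z_commute[of i j])
  show "(1 + z i) * u k l = u k l * (1 + z i)" if "k < l" "i \<notin> {k, l}"
    using z_u_commute[OF that] by (simp add: algebra_simps)
  show "(1 + z i) * u i j = u i j * (1 + z j) + b * (1 + z i) + (h_lift j - b)" if "i < j"
    using z_u[OF that] by (simp add: algebra_simps)
  show "(1 + z j) * u i j = u i j * (1 + z i) - b * (1 + z i) - (h_lift j - b)" if "i < j"
    using z_u'[OF that] by (simp add: algebra_simps)
qed (fact t_central b_central q_central u_commute u_braid u_braid' u_square)+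

lemma unital_scal_mult: "c \<in> coeff_ring n \<Longrightarrow> d \<in> coeff_ring n \<Longrightarrow>
    unital_scal (c * d) = unital_scal c * unital_scal d"
proof -
  assume cd: "c \<in> coeff_ring n" "d \<in> coeff_ring n"
  have "const (c * d - 1) = const (c - 1) + const (d - 1) + const (c - 1) * const (d - 1)"
    by (simp add: algebra_simps flip: const_simps)
  then show ?thesis
    using cd by (simp add: unital_scal_def lift_cls_hom in_free_alg coeff_ring_diff coeff_ring_1
        algebra_simps)
qed

lemma lift_cls_0: "lift_cls n 0 = 0"
  using lift_cls_hom(3)[of "const beta" n "const beta"] by (simp add: in_free_alg)

lemma unital_scal_1: "unital_scal 1 = 1"
  by (simp add: unital_scal_def const_simps lift_cls_0)

lemma lift_cls_mult_unital_scal: "c \<in> coeff_ring n \<Longrightarrow> d \<in> coeff_ring n \<Longrightarrow>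
    lift_cls n (const c) * unital_scal d = lift_cls n (const (c * d))"
proof -
  assume cd: "c \<in> coeff_ring n" "d \<in> coeff_ring n"
  have "const (c * d) = const c + const c * const (d - 1)"
    by (simp add: algebra_simps flip: const_simps)
  then show ?thesis
    using cd by (simp add: unital_scal_def lift_cls_hom in_free_alg coeff_ring_diff coeff_ring_1
        algebra_simps)
qed

lemma component_const: "c \<in> coeff_ring n \<Longrightarrow> component (HT n) (lift_cls n (const c)) = scal n c"
  by (simp add: component_lift_cls in_free_alg scal_def)

lemma component_unital_scal:
  assumes "c \<in> coeff_ring n" shows "component (HT n) (unital_scal c) = scal n c"
proof -
  have 1: "1 \<in> carrier (free_alg n)" using const_in_free_alg[OF coeff_ring_1] by (simp add: const_simps)
  have "component (HT n) (unital_scal c) = cls n 1 \<oplus>\<^bsub>HT n\<^esub> cls n (const (c - 1))"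
    using assms ring_hom_one[OF cls_hom, of n]
    by (simp add: unital_scal_def component_simps ring_HT component_lift_cls in_free_alg
        coeff_ring_diff coeff_ring_1 free_alg_ops)
  also have "\<dots> = cls n (1 + const (c - 1))"
    using ring_hom_add[OF cls_hom 1, of "const (c - 1)"] assms
    by (simp add: free_alg_ops in_free_alg coeff_ring_diff coeff_ring_1)
  also have "1 + const (c - 1) = const c"
    by (simp flip: const_simps)
  finally show ?thesis by (simp add: scal_def)
qed

lemma w_unital_scal: "w = unital_scal (1 + tpar * beta)"
  by (simp add: w_def unital_scal_def const_simps lift_cls_hom in_free_alg)

lemma w_in_coeff_ring: "1 + tpar * beta \<in> coeff_ring n"
  by (intro coeff_ring_add coeff_ring_1 coeff_ring_mult tpar_in_coeff_ring beta_in_coeff_ring)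

lemma w_power_unital_scal: "w ^ r = unital_scal ((1 + tpar * beta) ^ r)"
  by (induction r) (simp_all add: unital_scal_1 w_unital_scal unital_scal_mult w_in_coeff_ring
      coeff_ring_power)

lemma lift_cls_sum: "(\<And>i. i < (r :: nat) \<Longrightarrow> c i \<in> coeff_ring n) \<Longrightarrow>
    (\<Sum>i<r. lift_cls n (const (c i))) = lift_cls n (const (\<Sum>i<r. c i))"
proof (induction r)
  case (Suc r)
  have "sum c {..<r} \<in> coeff_ring n" by (rule coeff_ring_sum) (use Suc.prems in auto)
  then show ?case using Suc by (simp add: const_simps lift_cls_hom in_free_alg)
qed (simp add: const_simps lift_cls_0)

lemma power_quot_in_coeff_ring: "power_quot r \<in> coeff_ring n"
  unfolding power_quot_eq
  by (intro coeff_ring_mult coeff_ring_sum coeff_ring_power w_in_coeff_ring tpar_in_coeff_ring)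

lemma t_geometric: "t * geometric r = lift_cls n (const (power_quot r))"
  unfolding power_quot_eq geometric_def sum_distrib_left w_power_unital_scal
  by (simp add: lift_cls_mult_unital_scal lift_cls_sum coeff_ring_mult tpar_in_coeff_ring
      coeff_ring_power w_in_coeff_ring)

lemma kappa_unital_scal:
  assumes "i < j" "j < n" shows "kappa i j = unital_scal (kap (Suc i) (Suc j))"
proof -
  have "const (kap (Suc i) (Suc j) - 1)
      = const (tpar * beta) - const tpar * const tpar * const (qpar (Suc i) (Suc j))"
  proof -
    have "kap (Suc i) (Suc j) - 1 + tpar * tpar * qpar (Suc i) (Suc j) = tpar * beta"
      by (simp add: kap_def power2_eq_square mult.commute)
    then have "const (kap (Suc i) (Suc j) - 1) + const (tpar * tpar * qpar (Suc i) (Suc j))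
        = const (tpar * beta)"
      by (metis const_simps(1))
    then show ?thesis by (simp add: eq_diff_eq const_simps(2))
  qed
  then have "lift_cls n (const (kap (Suc i) (Suc j) - 1)) = t * b - t * t * q i j"
    using assms by (simp add: q_def lift_cls_hom in_free_alg const_simps(2))
  then show ?thesis by (simp add: kappa_def unital_scal_def w_def add_diff_eq)
qed

sublocale dunkl_algebra_inv b t u q "\<lambda>i. 1 + z i" "\<lambda>i. h_lift i - b" kappa_inv n
proof
  fix i j :: nat and y :: "nc_poly set ring_prod"
  show "y * kappa_inv i j = kappa_inv i j * y"
    by (simp add: kappa_inv_def unital_scal_def algebra_simps lift_cls_const_central coeff_ring_diff
        kap_in_coeff_ring coeff_ring_1)
  show "kappa i j * kappa_inv i j = 1" if "i < j" "j < n"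
    using that by (simp add: kappa_unital_scal kappa_inv_def kap_in_coeff_ring kap_nonzero
        unital_scal_1 flip: unital_scal_mult)
qed

abbreviation proj :: "nc_poly set ring_prod \<Rightarrow> nc_poly set" where "proj \<equiv> component (HT n)"

lemma proj_h: "i < j \<Longrightarrow> j < n \<Longrightarrow> proj (h i j) = ht_h n (Suc i) (Suc j)"
  by (simp add: h_def uu_def u_def component_simps ring_HT component_lift_cls in_free_alg ht_h_def
      scal_def ht_u_def)

lemma proj_h_inverse:
  assumes "j < i" "i < n" shows "proj (kappa_inv j i * h i j) = inv\<^bsub>HT n\<^esub> ht_h n (Suc j) (Suc i)"
proof (rule monoid.inv_unique'[OF ring.is_monoid[OF ring_HT]])
  have "kappa j i * kappa_inv j i = 1" using assms by (intro kappa_kappa_inv)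
  then have "h j i * h i j * kappa_inv j i = 1" "kappa_inv j i * (h i j * h j i) = 1"
    using h_mult_flip[OF assms(1)] kappa_inv_central[of "kappa j i"] by simp_all
  then have "h j i * (kappa_inv j i * h i j) = 1" "kappa_inv j i * h i j * h j i = 1"
    using kappa_inv_central[of "h i j"] by (simp_all add: mult.assoc)
  then show "ht_h n (Suc j) (Suc i) \<otimes>\<^bsub>HT n\<^esub> proj (kappa_inv j i * h i j) = \<one>\<^bsub>HT n\<^esub>"
    "proj (kappa_inv j i * h i j) \<otimes>\<^bsub>HT n\<^esub> ht_h n (Suc j) (Suc i) = \<one>\<^bsub>HT n\<^esub>"
    unfolding proj_h[OF assms, symmetric] component_simps(4)[OF ring_HT, symmetric]
    by (simp_all add: component_simps ring_HT)
  show "ht_h n (Suc j) (Suc i) \<in> carrier (HT n)" "proj (kappa_inv j i * h i j) \<in> carrier (HT n)"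
    using component_closed[OF ring_HT, of n] proj_h[OF assms] by metis+
qed

lemma proj_dunkl:
  assumes "i < n" shows "proj (dunkl_elt n i) = dunkl n (Suc i)"
proof -
  have 1: "[1..<Suc i] = map Suc [0..<i]" "[Suc (Suc i)..<Suc n] = map Suc [Suc i..<n]"
    by (simp_all add: map_Suc_upt)
  have "filter (\<lambda>j. j \<in> {..<i}) [0..<i] = [0..<i]" by (simp add: filter_id_conv)
  moreover have "filter (\<lambda>j. j \<in> {i<..}) [0..<n] = [Suc i..<n]"
  proof -
    have "[0..<n] = [0..<Suc i] @ [Suc i..<n]"
        using assms upt_add_eq_append[of 0 "Suc i" "n - Suc i"] by simp
    moreover have "filter (\<lambda>j. j \<in> {i<..}) [0..<Suc i] = []" by (auto simp: filter_empty_conv)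
    moreover have "filter (\<lambda>j. j \<in> {i<..}) [Suc i..<n] = [Suc i..<n]" by (auto simp: filter_id_conv)
    ultimately show ?thesis by (metis filter_append append_Nil)
  qed
  moreover have "map (\<lambda>j. proj (kappa_inv j i * h i j)) (rev [0..<i])
    = map (\<lambda>j. inv\<^bsub>HT n\<^esub> ht_h n j (Suc i)) (map Suc (rev [0..<i]))"
    unfolding map_map o_def by (intro map_cong refl proj_h_inverse) (use assms in auto)
  moreover have "map (\<lambda>j. proj (h i j)) (rev [Suc i..<n])
      = map (ht_h n (Suc i)) (map Suc (rev [Suc i..<n]))"
    unfolding map_map o_def by (intro map_cong refl proj_h) auto
  moreover have "proj (1 + z i) = \<one>\<^bsub>HT n\<^esub> \<oplus>\<^bsub>HT n\<^esub> ht_z n (Suc i)"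
    using assms by (simp add: component_simps ring_HT z_def component_lift_cls in_free_alg ht_z_def)
  ultimately show ?thesis
    unfolding dunkl_elt_def desc_prod_eq_prod_list dunkl_def 1 rev_map
    by (simp only: component_simps(4)[OF ring_HT] component_prod_list[OF ring_HT] map_map o_def)
qed

lemma proj_dunkl_prod:
  "m \<le> n \<Longrightarrow> proj (asc_prod I (dunkl_elt n) m) = dunkl_prod n (Suc ` (I \<inter> {..<m}))"
proof -
  assume "m \<le> n"
  let ?xs = "map Suc (filter (\<lambda>i. i \<in> I) [0..<m])"
  have "sorted_list_of_set (set ?xs) = ?xs"
    by (rule sorted_list_of_set.idem_if_sorted_distinct) (auto simp: sorted_map distinct_map
        intro: sorted_filter sorted_wrt_filter)
  moreover have "set ?xs = Suc ` (I \<inter> {..<m})" by auto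
  ultimately have "sorted_list_of_set (Suc ` (I \<inter> {..<m})) = ?xs" by simp
  then show ?thesis
    using \<open>m \<le> n\<close> by (auto simp: dunkl_prod_def asc_prod_eq_prod_list component_prod_list ring_HT
        proj_dunkl o_def
      intro!: arg_cong[where f = "list_prod (HT n)"])
qed

lemma unital_scal_asc_prod: "(\<And>i. i < m \<Longrightarrow> i \<in> S \<Longrightarrow> f i \<in> coeff_ring n) \<Longrightarrow>
    asc_prod S (\<lambda>i. unital_scal (f i)) m = unital_scal (asc_prod S f m) \<and> asc_prod S f m \<in> coeff_ring n"
  by (induction m) (auto simp: unital_scal_1 coeff_ring_1 unital_scal_mult coeff_ring_mult)

lemma unital_scal_desc_prod: "(\<And>i. i < m \<Longrightarrow> i \<in> S \<Longrightarrow> f i \<in> coeff_ring n) \<Longrightarrow>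
    desc_prod S (\<lambda>i. unital_scal (f i)) m
    = unital_scal (desc_prod S f m) \<and> desc_prod S f m \<in> coeff_ring n"
  by (induction m) (auto simp: unital_scal_1 coeff_ring_1 unital_scal_mult coeff_ring_mult)

lemma proj_weight:
  assumes "I \<subseteq> {..<n}"
  shows "proj (weight I n) = scal n (\<Prod>(i, j) \<in> {(i, j). i \<in> {1..n} - Suc ` I \<and> j \<in> Suc ` I \<and> i < j}.
      kap i j)"
proof -
  define f where "f i = desc_prod (- I) (\<lambda>j. kap (Suc j) (Suc i)) i" for i
  have f: "desc_prod (- I) (\<lambda>j. kappa j i) i = unital_scal (f i) \<and> f i \<in> coeff_ring n" if "i < n" for i
  proof -
    have "desc_prod (- I) (\<lambda>j. kappa j i) i = desc_prod (- I) (\<lambda>j. unital_scal (kap (Suc j) (Suc i))) i"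
      by (rule desc_prod_cong) (use that in \<open>auto simp: kappa_unital_scal\<close>)
    then show ?thesis
      using unital_scal_desc_prod[of i "- I" "\<lambda>j. kap (Suc j) (Suc i)"] that
          by (simp add: f_def kap_in_coeff_ring)
  qed
  have "weight I n = asc_prod I (\<lambda>i. unital_scal (f i)) n"
    unfolding weight_def by (rule asc_prod_cong) (auto simp: f)
  then have "proj (weight I n) = scal n (asc_prod I f n)"
    using unital_scal_asc_prod[of n I f] f by (simp add: component_unital_scal)
  also have "asc_prod I f n = (\<Prod>i \<in> I \<inter> {..<n}. \<Prod>j \<in> - I \<inter> {..<i}. kap (Suc j) (Suc i))"
    by (simp add: asc_prod_eq_prod desc_prod_eq_prod f_def)
  also have "\<dots> = (\<Prod>(i, j) \<in> (SIGMA i : I \<inter> {..<n}. - I \<inter> {..<i}). kap (Suc j) (Suc i))"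
    by (rule prod.Sigma) auto
  also have "\<dots> = (\<Prod>(i, j) \<in> {(i, j). i \<in> {1..n} - Suc ` I \<and> j \<in> Suc ` I \<and> i < j}. kap i j)"
    by (rule prod.reindex_bij_witness[where i = "\<lambda>(i, j). (j - 1, i - 1)" and j
        = "\<lambda>(i, j). (Suc j, Suc i)"])
       (use assms in \<open>auto simp: image_iff less_Suc_eq_le Suc_le_eq\<close>)
  finally show ?thesis .
qed

lemma proj_rhs_factor:
  assumes "is \<in> strict_lists n k" "a \<in> set [1..<Suc k]"
  shows "proj (rhs_factor n k is a) = (let m = is ! (a - 1) in
             scal n ((1 + tpar * beta) ^ (n + a - (k + m)))
             \<otimes>\<^bsub>HT n\<^esub> (ht_z n m \<otimes>\<^bsub>HT n\<^esub> scal n ((1 + tpar * beta) ^ (m - a))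
                  \<oplus>\<^bsub>HT n\<^esub> \<one>\<^bsub>HT n\<^esub>
                  \<oplus>\<^bsub>HT n\<^esub> scal n (hpar m * power_quot (m - a))))"
proof -
  define m where "m = is ! (a - 1)"
  have "m \<in> set is" unfolding m_def using assms by (intro nth_mem) (auto simp: strict_lists_def)
  then have m: "1 \<le> m" "m \<le> n" using assms by (auto simp: strict_lists_def)
  let ?r = "m - a"
  have "t * (h_lift (m - 1) - b) * geometric ?r
      = h_lift (m - 1) * (t * geometric ?r) - t * b * geometric ?r"
    by (simp only: right_diff_distrib left_diff_distrib h_lift_central[of t] mult.assoc)
  then have "(1 + z (m - 1)) * w ^ ?r + t * (h_lift (m - 1) - b) * geometric ?r
      = z (m - 1) * w ^ ?r + 1 + h_lift (m - 1) * (t * geometric ?r)"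
    using w_power_eq[of ?r] by (simp add: distrib_right)
  also have "h_lift (m - 1) * (t * geometric ?r) = lift_cls n (const (hpar m * power_quot ?r))"
  proof -
    have "h_lift (m - 1) = lift_cls n (const (hpar m))"
      using m by (cases m) (auto simp: h_lift_def)
    then show ?thesis
      using m by (simp add: t_geometric const_simps(2) lift_cls_hom in_free_alg power_quot_in_coeff_ring)
  qed
  finally have "rhs_factor n k is a = w ^ (n + a - (k + m)) *
     (z (m - 1) * w ^ ?r + 1 + lift_cls n (const (hpar m * power_quot ?r)))"
    by (simp add: rhs_factor_def Let_def m_def)
  moreover have "z (m - 1) = lift_cls n (gen_z m)"
    using m by (cases m) (auto simp: z_def)
  ultimately show ?thesis
    unfolding Let_def m_def[symmetric] using m
    by (simp add: component_simps ring_HT w_power_unital_scal component_unital_scal component_const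
        coeff_ring_power w_in_coeff_ring
        coeff_ring_mult power_quot_in_coeff_ring hpar_in_coeff_ring component_lift_cls in_free_alg
            ht_z_def
        scal_def[of n "hpar m * power_quot ?r"])
qed

end

theorem theorem3p4:
  fixes n k :: nat
  assumes "n \<ge> 2" and "1 \<le> k" and "k \<le> n"
  shows
    "(\<Oplus>\<^bsub>HT n\<^esub> I \<in> {I. I \<subseteq> {1..n} \<and> card I = k}.
        dunkl_prod n I
        \<otimes>\<^bsub>HT n\<^esub> scal n (\<Prod>(i, j) \<in> {(i, j). i \<in> {1..n} - I \<and> j \<in> I \<and> i < j}. kap i j))
     = (\<Oplus>\<^bsub>HT n\<^esub> is \<in> {is :: nat list. length is = k \<and> sorted_wrt (<) is \<and> set is \<subseteq> {1..n}}.
        list_prod (HT n) (map (\<lambda>a.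
          (let m = is ! (a - 1) in
             scal n ((1 + tpar * beta) ^ (n + a - (k + m)))
             \<otimes>\<^bsub>HT n\<^esub> (ht_z n m \<otimes>\<^bsub>HT n\<^esub> scal n ((1 + tpar * beta) ^ (m - a))
                  \<oplus>\<^bsub>HT n\<^esub> \<one>\<^bsub>HT n\<^esub>
                  \<oplus>\<^bsub>HT n\<^esub> scal n (hpar m * power_quot (m - a)))))
          [1..<Suc k]))"
    (is "finsum _ ?f ?T = finsum _ ?g ?S")
proof -
  interpret ht_lift n .
  interpret R: ring "HT n" by (rule ring_HT)
  let ?L = "\<lambda>I. asc_prod I (dunkl_elt n) n * weight I n"
  have "(\<Sum>I \<in> {I. I \<subseteq> {..<n} \<and> card I = k}. ?L I) = (\<Sum>I \<in> {I. I \<subseteq> {1..n} \<and> card I = k}. ?L (Suc -` I))"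
  proof (rule sum.reindex_bij_witness[where i = "\<lambda>I. Suc -` I" and j = "image Suc"])
    fix I assume I: "I \<in> {I. I \<subseteq> {1..n} \<and> card I = k}"
    then have *: "Suc ` (Suc -` I) = I" by (auto simp: image_iff) (metis Suc_le_D atLeastAtMost_iff subsetD One_nat_def)
    then show "Suc ` (Suc -` I) = I" .
    have "card (Suc -` I) = k" using card_image[of Suc "Suc -` I"] I * by simp
    then show "Suc -` I \<in> {I. I \<subseteq> {..<n} \<and> card I = k}" using I by auto
  qed (auto simp: card_image inj_vimage_image_eq)
  then have "proj (dunkl_sum n k) = (\<Oplus>\<^bsub>HT n\<^esub> I \<in> ?T. proj (?L (Suc -` I)))"
    by (simp only: dunkl_sum_eq_dunkl_elts[OF order_refl] component_sum[OF ring_HT])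
  also have "\<dots> = finsum (HT n) ?f ?T"
  proof -
    have f: "proj (?L (Suc -` I)) = ?f I" if "I \<in> ?T" for I
    proof -
      have I: "I \<subseteq> {1..n}" using that by auto
      then have "Suc ` (Suc -` I) = I" by (auto simp: image_iff) (metis Suc_le_D atLeastAtMost_iff subsetD One_nat_def)
      moreover have J: "Suc -` I \<subseteq> {..<n}" using I by auto
      ultimately show ?thesis
        using proj_dunkl_prod[of n "Suc -` I"] proj_weight[OF J]
        by (simp add: component_simps ring_HT Int_absorb2)
    qed
    then have "?f \<in> ?T \<rightarrow> carrier (HT n)"
      by (metis (no_types, lifting) Pi_I component_closed[OF ring_HT])
    then show ?thesis
      by (rule R.finsum_cong'[OF refl _ f])
  qed
  finally have lhs: "proj (dunkl_sum n k) = finsum (HT n) ?f ?T" .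
  have g: "proj (prod_list (map (rhs_factor n k is) [1..<Suc k])) = ?g is" if "is \<in> ?S" for "is"
  proof -
    have "is \<in> strict_lists n k" using that by (simp add: strict_lists_def)
    then show ?thesis
      unfolding component_prod_list[OF ring_HT] map_map o_def
      by (intro arg_cong[OF map_cong[OF refl]] proj_rhs_factor)
  qed
  have "proj (dunkl_sum n k) = (\<Oplus>\<^bsub>HT n\<^esub> is \<in> ?S. proj (prod_list (map (rhs_factor n k is) [1..<Suc k])))"
    by (simp only: dunkl_sum_eq_lists component_sum[OF ring_HT] strict_lists_def)
  also have "\<dots> = finsum (HT n) ?g ?S"
  proof -
    have "?g \<in> ?S \<rightarrow> carrier (HT n)"
      using g by (metis (no_types, lifting) Pi_I component_closed[OF ring_HT])
    then show ?thesis
      by (rule R.finsum_cong'[OF refl _ g])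
  qed
  finally show ?thesis using lhs by (simp only:)
qed

unused_thms

end
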